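(* Let $\boldsymbol{\mu}$ be an admissible scheduling process and $\mathbf{y}$ an $\mathbb{R}^{n_y}$-valued process. Assume that $\mathbf{y}$ is SII w.r.t. $\boldsymbol{\mu}$ and that $(\mathbf{y},\boldsymbol{\mu})$ is full rank. Let $\mathcal{S}=(\{A_i,K_i\}_{i=1}^{n_\mu},C,I_{n_y},\mathbf{v})$ be an asLPV-SSA realization of $(\mathbf{y},\boldsymbol{\mu})$ (with $F=I_{n_y}$) which is stably invertable w.r.t. $\boldsymbol{\mu}$, i.e. all eigenvalues of the matrix $\sum_{i=1}^{n_\mu} p_i (A_i-K_iC)\otimes(A_i-K_iC)$ are inside the open complex unit disk. Then $\mathcal{S}$ is in innovation form, i.e. $\mathbf{v}$ equals the innovation process $\mathbf{e}$ of $\mathbf{y}$ with respect to $\boldsymbol{\mu}$.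
   Context: All random variables live on a fixed probability space; all processes are discrete-time with time axis $\mathbb{Z}$. Words. $\Sigma=\{1,\dots,n_\mu\}$; $\Sigma^+$ is the set of nonempty finite words over $\Sigma$, $\epsilon$ is the empty word, $\Sigma^*=\Sigma^+\cup\{\epsilon\}$, $|w|$ is the length of $w$, and $vw$ denotes concatenation. Scheduling products. $\boldsymbol{\mu}=[\boldsymbol{\mu}_1,\dots,\boldsymbol{\mu}_{n_\mu}]^T$ is a real vector-valued process. For $w=\sigma_1\cdots\sigma_k\in\Sigma^+$, $\boldsymbol{\mu}_w(t)=\boldsymbol{\mu}_{\sigma_1}(t-k+1)\boldsymbol{\mu}_{\sigma_2}(t-k+2)\cdots\boldsymbol{\mu}_{\sigma_k}(t)$, and $\boldsymbol{\mu}_\epsilon(t)=1$. Admissible scheduling. $\boldsymbol{\mu}$ is admissible if: (i) with $\mathscr{F}_t^{\boldsymbol{\mu},-}$ the $\sigma$-algebra generated by $\{\boldsymbol{\mu}(k)\}_{k<t}$, there are positive numbers $\{p_\sigma\}_{\sigma\in\Sigma}$ such that for all $w,v\in\Sigma^+$, $\sigma,\sigma'\in\Sigma$, $t\in\mathbb{Z}$: $E[\boldsymbol{\mu}_{w\sigma}(t)\boldsymbol{\mu}_{v\sigma'}(t)\mid\mathscr{F}_t^{\boldsymbol{\mu},-}]$ equals $p_\sigma\boldsymbol{\mu}_w(t-1)\boldsymbol{\mu}_v(t-1)$ if $\sigma=\sigma'$ and $0$ otherwise; $E[\boldsymbol{\mu}_{w\sigma}(t)\boldsymbol{\mu}_{\sigma'}(t)\mid\mathscr{F}_t^{\boldsymbol{\mu},-}]$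 equals $p_\sigma\boldsymbol{\mu}_w(t-1)$ if $\sigma=\sigma'$ and $0$ otherwise; $E[\boldsymbol{\mu}_\sigma(t)\boldsymbol{\mu}_{\sigma'}(t)\mid\mathscr{F}_t^{\boldsymbol{\mu},-}]=0$ if $\sigma\neq\sigma'$; (ii) there are real numbers $\{\alpha_\sigma\}_{\sigma\in\Sigma}$ with $\sum_{\sigma\in\Sigma}\alpha_\sigma\boldsymbol{\mu}_\sigma(t)=1$ for all $t$; (iii) for all $w,v\in\Sigma^+$ the process $[\boldsymbol{\mu}_w,\boldsymbol{\mu}_v]^T$ is wide-sense stationary. The scheduling process is assumed admissible throughout; it determines $\{p_\sigma\}$. Put $p_w=p_{\sigma_1}\cdots p_{\sigma_k}$ for $w=\sigma_1\cdots\sigma_k$, $p_\epsilon=1$. For a process $\mathbf{r}$ and $w\in\Sigma^*$, $\mathbf{z}^{\mathbf{r}}_w(t)=\mathbf{r}(t-|w|)\,\boldsymbol{\mu}_w(t-1)\frac{1}{\sqrt{p_w}}$ (so $\mathbf{z}^{\mathbf r}_\epsilon=\mathbf{r}$). ZMWSII. $\mathbf{r}$ is ZMWSII w.r.t. $\boldsymbol{\mu}$ if (1) for all $t$, the $\sigma$-algebras generated by $\{\mathbf{r}(k)\}_{k\le t}$ and by $\{\boldsymbol{\mu}_\sigma(k)\}_{k\ge t,\sigma\in\Sigma}$ are conditionally independent given the one generated by $\{\boldsymbol{\mu}_\sigma(k)\}_{k<t,\sigma\in\Sigma}$; (2) $\mathbf{r}$ and $\mathbf{z}^{\mathbf{r}}_w$,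 $w\in\Sigma^+$, are zero mean, square integrable and jointly wide-sense stationary: for all $t,s,k\in\mathbb{Z}$, $w,v\in\Sigma^+$, the expectations $E[\mathbf{r}(t+k)(\mathbf{z}^{\mathbf r}_w(s+k))^T]$, $E[\mathbf{r}(t+k)(\mathbf{r}(s+k))^T]$, $E[\mathbf{z}^{\mathbf r}_w(t+k)(\mathbf{z}^{\mathbf r}_v(s+k))^T]$ do not depend on $k$. SII. $\mathbf{r}$ is SII w.r.t. $\boldsymbol{\mu}$ if for all $w\in\Sigma^*$, $t\in\mathbb{Z}$ the random variable $\mathbf{r}(t+|w|)\boldsymbol{\mu}_w(t+|w|-1)\frac{1}{\sqrt{p_w}}$ is square integrable. asLPV-SSA. A stationary autonomous stochastic LPV-SSA (asLPV-SSA), written $\mathcal{S}=(\{A_\sigma,K_\sigma\}_{\sigma=1}^{n_\mu},C,F,\mathbf{v})$, is a system $\mathbf{x}(t+1)=\sum_{i=1}^{n_\mu}(A_i\mathbf{x}(t)+K_i\mathbf{v}(t))\boldsymbol{\mu}_i(t)$, $\mathbf{y}(t)=C\mathbf{x}(t)+F\mathbf{v}(t)$, $t\in\mathbb{Z}$, with $A_\sigma\in\mathbb{R}^{n_x\times n_x}$, $K_\sigma\in\mathbb{R}^{n_x\times m}$, $C\in\mathbb{R}^{n_y\times n_x}$, $F\in\mathbb{R}^{n_y\times m}$, state process $\mathbf{x}$, noise process $\mathbf{v}$, output process $\mathbf{y}$, such that (1) $[\mathbf{x}^T,\mathbf{v}^T]^T$ is ZMWSII w.r.t. $\boldsymbol\mu$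 and $E[\mathbf{z}^{\mathbf x}_\sigma(t)(\mathbf{z}^{\mathbf v}_\sigma(t))^T]=0$, $E[\mathbf{v}(t)(\mathbf{z}^{\mathbf x}_w(t))^T]=0$ for all $\sigma\in\Sigma$, $w\in\Sigma^+$; (2) $\mathbf{v}$ is ZMWSII w.r.t. $\boldsymbol\mu$ and $E[\mathbf{v}(t)(\mathbf{z}^{\mathbf v}_w(t))^T]=0$ for all $w\in\Sigma^+$; (3) all eigenvalues of $\sum_{\sigma\in\Sigma}p_\sigma A_\sigma\otimes A_\sigma$ are inside the open unit disk. $\mathcal{S}$ is a realization of $(\tilde{\mathbf y},\tilde{\boldsymbol\mu})$ if its output and scheduling processes equal $\tilde{\mathbf y}$ and $\tilde{\boldsymbol\mu}$. Innovation. $\mathbf{e}(t)=\mathbf{y}(t)-E_l[\mathbf{y}(t)\mid\{\mathbf{z}^{\mathbf y}_w(t)\}_{w\in\Sigma^+}]$, where $E_l[\mathbf{z}\mid\mathfrak{S}]$ is the componentwise orthogonal projection, in the Hilbert space of real square-integrable random variables with inner product $E[\mathbf{z}_1\mathbf{z}_2]$, onto the smallest closed subspace containing all coordinates of the elements of $\mathfrak{S}$. An asLPV-SSA realization of $(\mathbf{y},\boldsymbol\mu)$ is in innovation form if $F=I_{n_y}$ and $\mathbf{v}=\mathbf{e}$. $(\mathbf{y},\boldsymbol\mu)$ is full rank if $Q_i=E[\mathbf{e}(t)(\mathbf{e}(t))^T\boldsymbol{\mu}_i^2(t)]$ is invertible for all $i=1,\dots,n_\mu$. *)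

theory Defs
  imports "HOL-Probability.Probability"
begin

text \<open>
  Conventions. The alphabet is a finite type \<open>'s\<close>, so its cardinality and the dimensions of all
  vectors are \<open>CARD(_)\<close> of finite types. A process is a function of time (\<open>int\<close>) with values in the
  random variables on a probability space \<open>M\<close>. Equality of random variables is almost sure equality.
\<close>

section \<open>Probabilistic notions\<close>

definition square_integrable :: "'a measure \<Rightarrow> ('a \<Rightarrow> 'b::euclidean_space) \<Rightarrow> bool" where
  "square_integrable M X \<longleftrightarrow> X \<in> borel_measurable M \<and> integrable M (\<lambda>\<omega>. (norm (X \<omega>))\<^sup>2)"

text \<open>The matrix \<open>E[X Y\<^sup>T]\<close>.\<close>

definition cross_moment :: "'a measure \<Rightarrow> ('a \<Rightarrow> real^'n) \<Rightarrow> ('a \<Rightarrow> real^'m) \<Rightarrow> real^'m^'n" where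
  "cross_moment M X Y = (\<chi> i j. \<integral>\<omega>. X \<omega> $ i * Y \<omega> $ j \<partial>M)"

definition wide_sense_stationary :: "'a measure \<Rightarrow> (int \<Rightarrow> 'a \<Rightarrow> real^'n) \<Rightarrow> bool" where
  "wide_sense_stationary M r \<longleftrightarrow>
     (\<forall>t. square_integrable M (r t)) \<and>
     (\<forall>t s. (\<integral>\<omega>. r t \<omega> \<partial>M) = (\<integral>\<omega>. r s \<omega> \<partial>M)) \<and>
     (\<forall>t s k. cross_moment M (r (t + k)) (r (s + k)) = cross_moment M (r t) (r s))"

definition generated_sigma ::
  "'a measure \<Rightarrow> 'i set \<Rightarrow> ('i \<Rightarrow> 'a \<Rightarrow> 'b::topological_space) \<Rightarrow> 'a measure" where
  "generated_sigma M I X = sigma (space M) {X i -` B \<inter> space M | i B. i \<in> I \<and> B \<in> sets borel}"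

definition cond_indep_sigma :: "'a measure \<Rightarrow> 'a measure \<Rightarrow> 'a measure \<Rightarrow> 'a measure \<Rightarrow> bool" where
  "cond_indep_sigma M F G H \<longleftrightarrow>
     (\<forall>A \<in> sets F. \<forall>B \<in> sets G. AE \<omega> in M.
        real_cond_exp M H (indicator (A \<inter> B)) \<omega> =
        real_cond_exp M H (indicator A) \<omega> * real_cond_exp M H (indicator B) \<omega>)"

section \<open>Orthogonal projection in the space of square integrable variables\<close>

text \<open>
  Random variables are not identified with their classes modulo almost sure equality; a closed
  subspace is automatically saturated under that equivalence, by the limit clause.
\<close>

definition L2_closed_subspace :: "'a measure \<Rightarrow> ('a \<Rightarrow> real) set \<Rightarrow> bool" where
  "L2_closed_subspace M V \<longleftrightarrow>
     (\<forall>X \<in> V. square_integrable M X) \<and>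
     (\<lambda>_. 0) \<in> V \<and>
     (\<forall>X \<in> V. \<forall>Y \<in> V. (\<lambda>\<omega>. X \<omega> + Y \<omega>) \<in> V) \<and>
     (\<forall>c. \<forall>X \<in> V. (\<lambda>\<omega>. c * X \<omega>) \<in> V) \<and>
     (\<forall>X Y. (\<forall>n. X n \<in> V) \<and> square_integrable M Y \<and>
        (\<lambda>n::nat. \<integral>\<omega>. (X n \<omega> - Y \<omega>)\<^sup>2 \<partial>M) \<longlonglongrightarrow> 0 \<longrightarrow> Y \<in> V)"

definition L2_closed_span :: "'a measure \<Rightarrow> ('a \<Rightarrow> real) set \<Rightarrow> ('a \<Rightarrow> real) set" where
  "L2_closed_span M S = \<Inter>{V. L2_closed_subspace M V \<and> S \<subseteq> V}"

text \<open>A version of the projection of \<open>X\<close>; any two versions are almost surely equal.\<close>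

definition lin_proj :: "'a measure \<Rightarrow> ('a \<Rightarrow> real) set \<Rightarrow> ('a \<Rightarrow> real) \<Rightarrow> 'a \<Rightarrow> real" where
  "lin_proj M S X = (SOME P. P \<in> L2_closed_span M S \<and>
     (\<forall>Z \<in> L2_closed_span M S. (\<integral>\<omega>. (X \<omega> - P \<omega>) * Z \<omega> \<partial>M) = 0))"

section \<open>Scheduling processes\<close>

definition sched_prod :: "(int \<Rightarrow> 'a \<Rightarrow> real^'s) \<Rightarrow> 's list \<Rightarrow> int \<Rightarrow> 'a \<Rightarrow> real" where
  "sched_prod \<mu> w t \<omega> = (\<Prod>j<length w. \<mu> (t - int (length w) + 1 + int j) \<omega> $ (w ! j))"

definition word_weight :: "('s \<Rightarrow> real) \<Rightarrow> 's list \<Rightarrow> real" where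
  "word_weight p w = prod_list (map p w)"

definition sched_past :: "'a measure \<Rightarrow> (int \<Rightarrow> 'a \<Rightarrow> real^'s) \<Rightarrow> int \<Rightarrow> 'a measure" where
  "sched_past M \<mu> t = generated_sigma M {..<t} \<mu>"

text \<open>
  The numbers \<open>p\<close> are a parameter of the predicate: they are uniquely determined by an admissible
  \<open>\<mu>\<close>.
\<close>

definition admissible :: "'a measure \<Rightarrow> (int \<Rightarrow> 'a \<Rightarrow> real^'s) \<Rightarrow> ('s::finite \<Rightarrow> real) \<Rightarrow> bool" where
  "admissible M \<mu> p \<longleftrightarrow>
     (\<forall>t. \<mu> t \<in> borel_measurable M) \<and>
     (\<forall>\<sigma>. p \<sigma> > 0) \<and>
     (\<forall>w v \<sigma> \<sigma>' t. w \<noteq> [] \<and> v \<noteq> [] \<longrightarrow> (AE \<omega> in M.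
        real_cond_exp M (sched_past M \<mu> t)
          (\<lambda>\<omega>. sched_prod \<mu> (w @ [\<sigma>]) t \<omega> * sched_prod \<mu> (v @ [\<sigma>']) t \<omega>) \<omega> =
        (if \<sigma> = \<sigma>' then p \<sigma> * sched_prod \<mu> w (t - 1) \<omega> * sched_prod \<mu> v (t - 1) \<omega> else 0))) \<and>
     (\<forall>w \<sigma> \<sigma>' t. w \<noteq> [] \<longrightarrow> (AE \<omega> in M.
        real_cond_exp M (sched_past M \<mu> t)
          (\<lambda>\<omega>. sched_prod \<mu> (w @ [\<sigma>]) t \<omega> * \<mu> t \<omega> $ \<sigma>') \<omega> =
        (if \<sigma> = \<sigma>' then p \<sigma> * sched_prod \<mu> w (t - 1) \<omega> else 0))) \<and>
     (\<forall>\<sigma> \<sigma>' t. \<sigma> \<noteq> \<sigma>' \<longrightarrow> (AE \<omega> in M.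
        real_cond_exp M (sched_past M \<mu> t) (\<lambda>\<omega>. \<mu> t \<omega> $ \<sigma> * \<mu> t \<omega> $ \<sigma>') \<omega> = 0)) \<and>
     (\<exists>\<alpha>. \<forall>t. AE \<omega> in M. (\<Sum>\<sigma>\<in>UNIV. \<alpha> \<sigma> * \<mu> t \<omega> $ \<sigma>) = 1) \<and>
     (\<forall>w v. w \<noteq> [] \<and> v \<noteq> [] \<longrightarrow>
        wide_sense_stationary M
          (\<lambda>t \<omega>. vector [sched_prod \<mu> w t \<omega>, sched_prod \<mu> v t \<omega>] :: real^2))"

section \<open>Processes related to the scheduling\<close>

definition zproc ::
  "(int \<Rightarrow> 'a \<Rightarrow> real^'s) \<Rightarrow> ('s \<Rightarrow> real) \<Rightarrow> (int \<Rightarrow> 'a \<Rightarrow> real^'n) \<Rightarrow> 's list \<Rightarrow> int \<Rightarrow> 'a \<Rightarrow> real^'n" where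
  "zproc \<mu> p r w t \<omega> =
     (sched_prod \<mu> w (t - 1) \<omega> * (1 / sqrt (word_weight p w))) *\<^sub>R r (t - int (length w)) \<omega>"

definition ZMWSII ::
  "'a measure \<Rightarrow> (int \<Rightarrow> 'a \<Rightarrow> real^'s) \<Rightarrow> ('s::finite \<Rightarrow> real) \<Rightarrow> (int \<Rightarrow> 'a \<Rightarrow> real^'n) \<Rightarrow> bool" where
  "ZMWSII M \<mu> p r \<longleftrightarrow>
     (\<forall>t. cond_indep_sigma M
        (generated_sigma M {..t} r)
        (generated_sigma M ({t..} \<times> UNIV) (\<lambda>(k, \<sigma>) \<omega>. \<mu> k \<omega> $ \<sigma>))
        (generated_sigma M ({..<t} \<times> UNIV) (\<lambda>(k, \<sigma>) \<omega>. \<mu> k \<omega> $ \<sigma>))) \<and>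
     (\<forall>t. square_integrable M (r t) \<and> (\<integral>\<omega>. r t \<omega> \<partial>M) = 0) \<and>
     (\<forall>w t. w \<noteq> [] \<longrightarrow>
        square_integrable M (zproc \<mu> p r w t) \<and> (\<integral>\<omega>. zproc \<mu> p r w t \<omega> \<partial>M) = 0) \<and>
     (\<forall>t s k.
        cross_moment M (r (t + k)) (r (s + k)) = cross_moment M (r t) (r s)) \<and>
     (\<forall>t s k w. w \<noteq> [] \<longrightarrow>
        cross_moment M (r (t + k)) (zproc \<mu> p r w (s + k)) =
        cross_moment M (r t) (zproc \<mu> p r w s)) \<and>
     (\<forall>t s k w v. w \<noteq> [] \<and> v \<noteq> [] \<longrightarrow>
        cross_moment M (zproc \<mu> p r w (t + k)) (zproc \<mu> p r v (s + k)) =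
        cross_moment M (zproc \<mu> p r w t) (zproc \<mu> p r v s))"

text \<open>Unlike \<^const>\<open>zproc\<close>, the next notion shifts time forward along the word.\<close>

definition SII ::
  "'a measure \<Rightarrow> (int \<Rightarrow> 'a \<Rightarrow> real^'s) \<Rightarrow> ('s \<Rightarrow> real) \<Rightarrow> (int \<Rightarrow> 'a \<Rightarrow> real^'n) \<Rightarrow> bool" where
  "SII M \<mu> p r \<longleftrightarrow>
     (\<forall>w t. square_integrable M
        (\<lambda>\<omega>. (sched_prod \<mu> w (t + int (length w) - 1) \<omega> * (1 / sqrt (word_weight p w)))
              *\<^sub>R r (t + int (length w)) \<omega>))"

definition innovation ::
  "'a measure \<Rightarrow> (int \<Rightarrow> 'a \<Rightarrow> real^'s) \<Rightarrow> ('s \<Rightarrow> real) \<Rightarrow> (int \<Rightarrow> 'a \<Rightarrow> real^'n) \<Rightarrow>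
    int \<Rightarrow> 'a \<Rightarrow> real^'n" where
  "innovation M \<mu> p y t \<omega> =
     y t \<omega> - (\<chi> i. lin_proj M {\<lambda>\<omega>. zproc \<mu> p y w t \<omega> $ j | w j. w \<noteq> []} (\<lambda>\<omega>. y t \<omega> $ i) \<omega>)"

text \<open>
  The first clause says that the expectation \<open>Q\<^sub>i\<close> exists; without it, the convention that the
  integral of a non-integrable function is \<open>0\<close> would make the second clause meaningless.
\<close>

definition full_rank ::
  "'a measure \<Rightarrow> (int \<Rightarrow> 'a \<Rightarrow> real^'s) \<Rightarrow> ('s \<Rightarrow> real) \<Rightarrow> (int \<Rightarrow> 'a \<Rightarrow> real^'n) \<Rightarrow> bool" where
  "full_rank M \<mu> p y \<longleftrightarrow>
     (\<forall>i t. let e = innovation M \<mu> p y in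
        (\<forall>k l. integrable M (\<lambda>\<omega>. e t \<omega> $ k * e t \<omega> $ l * (\<mu> t \<omega> $ i)\<^sup>2)) \<and>
        invertible ((\<chi> k l. \<integral>\<omega>. e t \<omega> $ k * e t \<omega> $ l * (\<mu> t \<omega> $ i)\<^sup>2 \<partial>M) :: real^'n^'n))"

section \<open>Matrices\<close>

definition kronecker :: "real^'n^'m \<Rightarrow> real^'q^'p \<Rightarrow> real^('n \<times> 'q)^('m \<times> 'p)" where
  "kronecker A B = (\<chi> i j. A $ fst i $ fst j * B $ snd i $ snd j)"

definition complex_eigenvalue :: "real^'n^'n \<Rightarrow> complex \<Rightarrow> bool" where
  "complex_eigenvalue A l \<longleftrightarrow>
     (\<exists>u :: complex^'n. u \<noteq> 0 \<and> (\<chi> i j. complex_of_real (A $ i $ j)) *v u = l *s u)"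

definition eigenvalues_in_open_unit_disk :: "real^'n^'n \<Rightarrow> bool" where
  "eigenvalues_in_open_unit_disk A \<longleftrightarrow> (\<forall>l. complex_eigenvalue A l \<longrightarrow> cmod l < 1)"

section \<open>Stochastic LPV state-space systems\<close>

definition stack ::
  "(int \<Rightarrow> 'a \<Rightarrow> real^'n) \<Rightarrow> (int \<Rightarrow> 'a \<Rightarrow> real^'m) \<Rightarrow> int \<Rightarrow> 'a \<Rightarrow> real^('n + 'm)" where
  "stack x v t \<omega> = (\<chi> i. case i of Inl a \<Rightarrow> x t \<omega> $ a | Inr b \<Rightarrow> v t \<omega> $ b)"

text \<open>\<open>asLPV_SSA M \<mu> p A K C F v x y\<close>: the system with state \<open>x\<close>, noise \<open>v\<close> and output \<open>y\<close>.\<close>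

definition asLPV_SSA ::
  "'a measure \<Rightarrow> (int \<Rightarrow> 'a \<Rightarrow> real^'s) \<Rightarrow> ('s::finite \<Rightarrow> real) \<Rightarrow>
   ('s \<Rightarrow> real^'nx^'nx) \<Rightarrow> ('s \<Rightarrow> real^'m^'nx) \<Rightarrow> real^'nx^'ny \<Rightarrow> real^'m^'ny \<Rightarrow>
   (int \<Rightarrow> 'a \<Rightarrow> real^'m) \<Rightarrow> (int \<Rightarrow> 'a \<Rightarrow> real^'nx) \<Rightarrow> (int \<Rightarrow> 'a \<Rightarrow> real^'ny) \<Rightarrow> bool" where
  "asLPV_SSA M \<mu> p A K C F v x y \<longleftrightarrow>
     (\<forall>t. AE \<omega> in M.
        x (t + 1) \<omega> = (\<Sum>i\<in>UNIV. (\<mu> t \<omega> $ i) *\<^sub>R (A i *v x t \<omega> + K i *v v t \<omega>))) \<and>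
     (\<forall>t. AE \<omega> in M. y t \<omega> = C *v x t \<omega> + F *v v t \<omega>) \<and>
     ZMWSII M \<mu> p (stack x v) \<and>
     (\<forall>\<sigma> t. cross_moment M (zproc \<mu> p x [\<sigma>] t) (zproc \<mu> p v [\<sigma>] t) = 0) \<and>
     (\<forall>w t. w \<noteq> [] \<longrightarrow> cross_moment M (v t) (zproc \<mu> p x w t) = 0) \<and>
     ZMWSII M \<mu> p v \<and>
     (\<forall>w t. w \<noteq> [] \<longrightarrow> cross_moment M (v t) (zproc \<mu> p v w t) = 0) \<and>
     eigenvalues_in_open_unit_disk (\<Sum>\<sigma>\<in>UNIV. p \<sigma> *\<^sub>R kronecker (A \<sigma>) (A \<sigma>))"

definition stably_invertible ::
  "('s::finite \<Rightarrow> real) \<Rightarrow> ('s \<Rightarrow> real^'nx^'nx) \<Rightarrow> ('s \<Rightarrow> real^'ny^'nx) \<Rightarrow> real^'nx^'ny \<Rightarrow> bool" where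
  "stably_invertible p A K C \<longleftrightarrow>
     eigenvalues_in_open_unit_disk
       (\<Sum>i\<in>UNIV. p i *\<^sub>R kronecker (A i - K i ** C) (A i - K i ** C))"

definition innovation_form ::
  "'a measure \<Rightarrow> (int \<Rightarrow> 'a \<Rightarrow> real^'s) \<Rightarrow> ('s::finite \<Rightarrow> real) \<Rightarrow>
   ('s \<Rightarrow> real^'nx^'nx) \<Rightarrow> ('s \<Rightarrow> real^'ny^'nx) \<Rightarrow> real^'nx^'ny \<Rightarrow> real^'ny^'ny \<Rightarrow>
   (int \<Rightarrow> 'a \<Rightarrow> real^'ny) \<Rightarrow> (int \<Rightarrow> 'a \<Rightarrow> real^'nx) \<Rightarrow> (int \<Rightarrow> 'a \<Rightarrow> real^'ny) \<Rightarrow> bool" where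
  "innovation_form M \<mu> p A K C F v x y \<longleftrightarrow>
     asLPV_SSA M \<mu> p A K C F v x y \<and> F = mat 1 \<and>
     (\<forall>t. AE \<omega> in M. v t \<omega> = innovation M \<mu> p y t \<omega>)"

end

theory Submission
  imports Defs "HOL-Complex_Analysis.Laurent_Convergence"
begin

text \<open>
  The output equation \<open>y = C x + v\<close> turns the state equation into a recursion driven by the
  output, \<open>x (t + 1) = (\<Sum>i. \<mu>\<^sub>i t (B\<^sub>i (x t) + K\<^sub>i (y t)))\<close> with \<open>B\<^sub>i = A\<^sub>i - K\<^sub>i C\<close>. Unrolling it over
  \<open>n\<close> steps writes \<open>x t\<close> as a finite linear combination of the variables \<open>z\<^sup>y\<^sub>w t\<close> with
  \<open>1 \<le> |w| \<le> n\<close>, plus the contribution \<open>R\<^sub>n\<close> of the old state \<open>x (t - n)\<close>. If \<open>R\<^sub>n\<close> tends to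
  \<open>0\<close> in mean square, then \<open>x t\<close> lies in the closed span of all \<open>z\<^sup>y\<^sub>w t\<close>. The noise \<open>v t\<close> is
  orthogonal to every \<open>z\<^sup>y\<^sub>w t = C z\<^sup>x\<^sub>w t + z\<^sup>v\<^sub>w t\<close> by the definition of the system class. So
  \<open>y t = C x t + v t\<close> splits into a part inside the closed span and a part orthogonal to it: the
  former is the projection of \<open>y t\<close>, and the latter is the innovation.

  The mean square of \<open>R\<^sub>n\<close> is computed exactly. Given the past of the scheduling and the past and
  present of the state and noise, the products \<open>\<mu>\<^sub>i u \<mu>\<^sub>j u\<close> have conditional mean \<open>p\<^sub>i\<close> if
  \<open>i = j\<close> and \<open>0\<close> otherwise (lemma \<open>scheduled_moment\<close>); for the past of the scheduling alone
  this follows from admissibility, and conditional independence adds the past of the state and noise. Hence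
  one step of the recursion acts on the matrix of second moments by
  \<open>P \<mapsto> (\<Sum>i. p\<^sub>i B\<^sub>i P B\<^sub>i\<^sup>T)\<close>, which is multiplication by the matrix
  \<open>\<Sum>i. p\<^sub>i B\<^sub>i \<otimes> B\<^sub>i\<close> once \<open>P\<close> is read as a vector. Stable invertibility says that the spectrum
  of this matrix lies in the open unit disk, so that its powers tend to \<open>0\<close>
  (lemma \<open>matrix_powers_tendsto_zero\<close>). Stationarity makes the starting value of the iteration, the
  second moments of \<open>x (t - n)\<close>, independent of \<open>n\<close>, and the convergence follows.
\<close>

(* The dollar sign is kept for vector components; power series coefficients are written fps_nth. *)
no_notation fps_nth (infixl "$" 75)

section \<open>Powers of a matrix with spectrum in the open unit disk\<close>

text \<open>
  A kernel vector of \<open>1 - z B\<close> is an eigenvector of \<open>B\<close> for the eigenvalue \<open>1 / z\<close>, which lies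
  outside the open unit disk.
\<close>

lemma det_resolvent_nonzero:
  fixes B :: "real^'n^'n" and z :: complex
  assumes "eigenvalues_in_open_unit_disk B" "norm z \<le> 1"
  shows "det (mat 1 - (\<chi> i j. z * complex_of_real (B $ i $ j))) \<noteq> 0"
proof
  let ?C = "(\<chi> i j. complex_of_real (B $ i $ j)) :: complex^'n^'n"
  let ?R = "mat 1 - (\<chi> i j. z * complex_of_real (B $ i $ j)) :: complex^'n^'n"
  assume "det ?R = 0"
  then have "\<not> invertible ?R"
    by (simp add: invertible_det_nz)
  then obtain u where u: "?R *v u = 0" "u \<noteq> 0"
    using matrix_left_invertible_ker[of ?R] invertible_left_inverse by metis
  have R: "?R *v u = u - z *s (?C *v u)"
    by (simp add: vec_eq_iff matrix_vector_mult_def left_diff_distrib sum_subtractf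
        sum_distrib_left mult.assoc mat_def if_distrib[where f="\<lambda>x. x * _"] cong: if_cong)
  have z0: "z \<noteq> 0"
    using u R by auto
  have "?C *v u = (1 / z) *s u"
    using u(1) z0 unfolding R by (simp add: vec_eq_iff field_simps)
  then have "complex_eigenvalue B (1 / z)"
    unfolding complex_eigenvalue_def using u(2) by blast
  then have "cmod (1 / z) < 1"
    using assms(1) unfolding eigenvalues_in_open_unit_disk_def by blast
  then show False
    using z0 assms(2) by (simp add: norm_divide field_simps)
qed

text \<open>
  By Cramer's rule the resolvent \<open>f z = (1 - z B)\<^sup>-\<^sup>1 q\<close> is rational in \<open>z\<close>, and its denominator
  \<open>det (1 - z B)\<close> has no zero in the closed unit disk, hence none in some larger disk. So the
  Taylor series of \<open>f\<close> at \<open>0\<close> converges at \<open>z = 1\<close>. The equation \<open>f z = q + z B (f z)\<close>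
  identifies its coefficients as \<open>B\<^sup>n q\<close>, and the terms of a convergent series tend to \<open>0\<close>.
\<close>

lemma matrix_powers_tendsto_zero:
  fixes B :: "real^'n^'n" and q :: "real^'n"
  assumes B: "eigenvalues_in_open_unit_disk B"
  shows "(\<lambda>n. (((*v) B) ^^ n) q $ a) \<longlonglongrightarrow> 0"
proof -
  define R where "R = (\<lambda>z. mat 1 - (\<chi> i j. z * complex_of_real (B $ i $ j)) :: complex^'n^'n)"
  define b where "b = (\<chi> i. complex_of_real (q $ i))"
  define f where "f = (\<lambda>k z. det (\<chi> i j. if j = k then b $ i else R z $ i $ j) / det (R z))"
  have R_entry: "(\<lambda>z. R z $ i $ j) holomorphic_on S" for i j S
    by (cases "i = j") (auto simp: R_def mat_def intro!: holomorphic_intros)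
  have det_hol: "(\<lambda>z. det (R z)) holomorphic_on S" for S
    unfolding det_def by (intro holomorphic_intros R_entry)
  define U where "U = {z. det (R z) \<noteq> 0}"
  have "open U"
    unfolding U_def using det_hol[of UNIV]
    by (intro open_Collect_neq continuous_intros holomorphic_on_imp_continuous_on)
  moreover have "cball 0 1 \<subseteq> U"
    using det_resolvent_nonzero[OF B] by (auto simp: U_def R_def)
  ultimately obtain \<epsilon> where e: "\<epsilon> > 0" "(\<Union>x\<in>cball 0 1. ball x \<epsilon>) \<subseteq> U"
    using compact_subset_open_imp_ball_epsilon_subset[OF compact_cball] by metis
  \<comment> \<open>points outside the unit disk are compared with their radial projection to the unit circle\<close>
  have ballU: "ball 0 (1 + \<epsilon>) \<subseteq> U"
  proof
    fix z :: complex assume z: "z \<in> ball 0 (1 + \<epsilon>)"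
    show "z \<in> U"
    proof (cases "norm z \<le> 1")
      case True
      then show ?thesis using \<open>cball 0 1 \<subseteq> U\<close> by auto
    next
      case False
      have "dist (z / of_real (norm z)) z = norm z - 1"
      proof -
        have "z / of_real (norm z) - z = z / of_real (norm z) * (1 - of_real (norm z))"
          using False by (cases "z = 0") (simp_all add: field_simps)
        then have "dist (z / of_real (norm z)) z = norm (1 - of_real (norm z) :: complex)"
          using False by (auto simp: dist_norm norm_mult norm_divide)
        also have "\<dots> = \<bar>1 - norm z\<bar>"
          by (metis norm_of_real of_real_1 of_real_diff)
        finally show ?thesis using False by simp
      qed
      moreover have "z / of_real (norm z) \<in> cball 0 1"
        using False by (simp add: norm_divide)
      ultimately show ?thesis
        using e z by (force simp: subset_iff)
    qed
  qed
  have f_hol: "f k holomorphic_on ball 0 (1 + \<epsilon>)" for k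
  proof -
    have "(\<lambda>z. (\<chi> i j. if j = k then b $ i else R z $ i $ j) $ i $ j) holomorphic_on ball 0 (1+\<epsilon>)" for i j
      by (cases "j = k") (simp_all add: R_entry)
    then have "(\<lambda>z. det (\<chi> i j. if j = k then b $ i else R z $ i $ j)) holomorphic_on ball 0 (1+\<epsilon>)"
      unfolding det_def by (intro holomorphic_intros) auto
    then show ?thesis
      unfolding f_def using ballU by (intro holomorphic_intros det_hol) (auto simp: U_def)
  qed
  define F where "F = (\<lambda>k. fps_expansion (f k) 0)"
  have fF: "f k has_fps_expansion F k" for k
    unfolding F_def using e(1) by (intro has_fps_expansion_fps_expansion[OF _ _ f_hol]) auto
  have conv: "fps_conv_radius (F k) \<ge> ereal (1 + \<epsilon>)" for k
    unfolding F_def using conv_radius_fps_expansion[of "f k" 0 "ereal (1 + \<epsilon>)"] f_hol by simp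
  \<comment> \<open>\<open>f\<close> solves the resolvent equation, by Cramer's rule\<close>
  have feq: "f k z = b $ k + z * (\<Sum>j\<in>UNIV. complex_of_real (B $ k $ j) * f j z)"
    if "z \<in> ball 0 (1 + \<epsilon>)" for k z
  proof -
    have "det (R z) \<noteq> 0" using that ballU by (auto simp: U_def)
    then have "R z *v (\<chi> k. f k z) = b"
      by (subst cramer) (auto simp: f_def)
    then have "(R z *v (\<chi> k. f k z)) $ k = b $ k" by simp
    moreover have "(R z *v (\<chi> k. f k z)) $ k = f k z - z * (\<Sum>j\<in>UNIV. complex_of_real (B $ k $ j) * f j z)"
      by (simp add: R_def matrix_vector_mult_def left_diff_distrib sum_subtractf
        sum_distrib_left mult.assoc mat_def if_distrib[where f="\<lambda>x. x * _"] cong: if_cong)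
    ultimately show ?thesis
      by (simp add: diff_eq_eq)
  qed
  have Feq: "F k = fps_const (b $ k) + fps_X * (\<Sum>j\<in>UNIV. fps_const (complex_of_real (B $ k $ j)) * F j)" for k
  proof -
    let ?G = "fps_const (b $ k) + fps_X * (\<Sum>j\<in>UNIV. fps_const (complex_of_real (B $ k $ j)) * F j)"
    have "(\<lambda>z. b $ k + z * (\<Sum>j\<in>UNIV. complex_of_real (B $ k $ j) * f j z)) has_fps_expansion ?G"
      by (intro fps_expansion_intros fF)
    moreover have "\<forall>\<^sub>F z in nhds 0. f k z = b $ k + z * (\<Sum>j\<in>UNIV. complex_of_real (B $ k $ j) * f j z)"
      using e(1) feq by (intro eventually_nhds_in_open[THEN eventually_mono, of "ball 0 (1 + \<epsilon>)"]) auto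
    ultimately have "f k has_fps_expansion ?G"
      using has_fps_expansion_cong by fast
    then show ?thesis
      using fps_expansion_unique_complex fF by blast
  qed
  have coef: "fps_nth (F k) n = complex_of_real ((((*v) B) ^^ n) q $ k)" for k n
  proof (induction n arbitrary: k)
    case 0
    show ?case by (subst Feq) (simp add: b_def)
  next
    case (Suc n)
    have "(B *v u) $ k = (\<Sum>j\<in>UNIV. B $ k $ j * u $ j)" for u
      by (simp add: matrix_vector_mult_def)
    then show ?case
      by (subst Feq) (simp add: Suc fps_sum_nth)
  qed
  have "summable (\<lambda>n. fps_nth (F a) n * 1 ^ n)"
    using e(1) by (intro summable_fps less_le_trans[OF _ conv]) simp
  then have "(\<lambda>n. fps_nth (F a) n) \<longlonglongrightarrow> 0"
    using summable_LIMSEQ_zero by auto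
  then have "(\<lambda>n. Re (fps_nth (F a) n)) \<longlonglongrightarrow> Re 0"
    by (intro tendsto_intros)
  then show ?thesis
    by (simp add: coef)
qed

section \<open>Closed subspaces of square integrable variables\<close>

lemma square_integrable_real_iff:
  "square_integrable M (f :: 'a \<Rightarrow> real) \<longleftrightarrow> f \<in> borel_measurable M \<and> integrable M (\<lambda>\<omega>. (f \<omega>)\<^sup>2)"
  by (simp add: square_integrable_def)

lemma square_integrable_mult:
  fixes f g :: "'a \<Rightarrow> real"
  assumes f: "square_integrable M f" and g: "square_integrable M g"
  shows "integrable M (\<lambda>\<omega>. f \<omega> * g \<omega>)"
proof (rule Bochner_Integration.integrable_bound)
  show "integrable M (\<lambda>\<omega>. (f \<omega>)\<^sup>2 + (g \<omega>)\<^sup>2)"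
    using f g by (simp add: square_integrable_real_iff)
  show "(\<lambda>\<omega>. f \<omega> * g \<omega>) \<in> borel_measurable M"
    using f g unfolding square_integrable_real_iff by (auto intro: borel_measurable_times)
  have "\<bar>a * b\<bar> \<le> \<bar>a\<^sup>2 + b\<^sup>2\<bar>" for a b :: real
    using sum_squares_bound[of a b] sum_squares_bound[of "-a" b] zero_le_power2[of a] zero_le_power2[of b]
    by (simp add: abs_le_iff)
  then show "AE \<omega> in M. norm (f \<omega> * g \<omega>) \<le> norm ((f \<omega>)\<^sup>2 + (g \<omega>)\<^sup>2)"
    by simp
qed

lemma square_integrable_add:
  fixes f g :: "'a \<Rightarrow> real"
  assumes "square_integrable M f" "square_integrable M g"
  shows "square_integrable M (\<lambda>\<omega>. f \<omega> + g \<omega>)"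
  using assms square_integrable_mult[OF assms]
  by (auto simp: square_integrable_real_iff power2_sum mult.assoc)

lemma square_integrable_cmult:
  fixes f :: "'a \<Rightarrow> real"
  assumes "square_integrable M f"
  shows "square_integrable M (\<lambda>\<omega>. c * f \<omega>)"
  using assms by (auto simp: square_integrable_real_iff power_mult_distrib)

lemma square_integrable_zero: "square_integrable M (\<lambda>_. 0 :: real)"
  by (simp add: square_integrable_real_iff)

lemma square_integrable_diff:
  fixes f g :: "'a \<Rightarrow> real"
  assumes "square_integrable M f" "square_integrable M g"
  shows "square_integrable M (\<lambda>\<omega>. f \<omega> - g \<omega>)"
  using square_integrable_add[OF assms(1) square_integrable_cmult[OF assms(2), of "-1"]] by simp

lemma square_integrable_sum:
  fixes f :: "'i \<Rightarrow> 'a \<Rightarrow> real"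
  assumes "\<And>i. i \<in> I \<Longrightarrow> square_integrable M (f i)"
  shows "square_integrable M (\<lambda>\<omega>. \<Sum>i\<in>I. f i \<omega>)"
  using assms
  by (induction I rule: infinite_finite_induct)
    (auto simp: square_integrable_zero intro: square_integrable_add)

lemma borel_measurable_vec_nth:
  fixes X :: "'a \<Rightarrow> real^'n"
  assumes "X \<in> borel_measurable M"
  shows "(\<lambda>\<omega>. X \<omega> $ i) \<in> borel_measurable M"
  using borel_measurable_inner[OF assms borel_measurable_const[of "axis i 1"]]
  by (simp add: inner_axis)

lemma square_integrable_nth:
  fixes X :: "'a \<Rightarrow> real^'n"
  assumes "square_integrable M X"
  shows "square_integrable M (\<lambda>\<omega>. X \<omega> $ i)"
proof -
  have X: "X \<in> borel_measurable M" "integrable M (\<lambda>\<omega>. (norm (X \<omega>))\<^sup>2)"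
    using assms by (auto simp: square_integrable_def)
  then have m: "(\<lambda>\<omega>. X \<omega> $ i) \<in> borel_measurable M"
    by (intro borel_measurable_vec_nth)
  have "integrable M (\<lambda>\<omega>. (X \<omega> $ i)\<^sup>2)"
  proof (rule Bochner_Integration.integrable_bound[OF X(2)])
    show "AE \<omega> in M. norm ((X \<omega> $ i)\<^sup>2) \<le> norm ((norm (X \<omega>))\<^sup>2)"
      by (auto intro!: power2_le_iff_abs_le[THEN iffD2] component_le_norm_cart)
  qed (use m in simp)
  with m show ?thesis by (simp add: square_integrable_real_iff)
qed

lemma
  assumes "L2_closed_subspace M V"
  shows L2_closed_subspaceD_square_integrable: "X \<in> V \<Longrightarrow> square_integrable M X"
    and L2_closed_subspaceD_zero: "(\<lambda>_. 0) \<in> V"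
    and L2_closed_subspaceD_add: "X \<in> V \<Longrightarrow> Y \<in> V \<Longrightarrow> (\<lambda>\<omega>. X \<omega> + Y \<omega>) \<in> V"
    and L2_closed_subspaceD_cmult: "X \<in> V \<Longrightarrow> (\<lambda>\<omega>. c * X \<omega>) \<in> V"
    and L2_closed_subspaceD_limit: "(\<And>n. Z n \<in> V) \<Longrightarrow> square_integrable M Y \<Longrightarrow>
      (\<lambda>n::nat. \<integral>\<omega>. (Z n \<omega> - Y \<omega>)\<^sup>2 \<partial>M) \<longlonglongrightarrow> 0 \<Longrightarrow> Y \<in> V"
proof -
  note * = assms[unfolded L2_closed_subspace_def]
  show "X \<in> V \<Longrightarrow> square_integrable M X" using * by blast
  show "(\<lambda>_. 0) \<in> V" using * by (elim conjE)
  show "X \<in> V \<Longrightarrow> Y \<in> V \<Longrightarrow> (\<lambda>\<omega>. X \<omega> + Y \<omega>) \<in> V"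
    using bspec[OF bspec[OF conjunct1[OF conjunct2[OF conjunct2[OF *]]]]] .
  show "X \<in> V \<Longrightarrow> (\<lambda>\<omega>. c * X \<omega>) \<in> V"
    using bspec[OF spec[OF conjunct1[OF conjunct2[OF conjunct2[OF conjunct2[OF *]]]]]] .
  show "(\<And>n. Z n \<in> V) \<Longrightarrow> square_integrable M Y \<Longrightarrow>
      (\<lambda>n::nat. \<integral>\<omega>. (Z n \<omega> - Y \<omega>)\<^sup>2 \<partial>M) \<longlonglongrightarrow> 0 \<Longrightarrow> Y \<in> V"
    using conjunct2[OF conjunct2[OF conjunct2[OF conjunct2[OF *]]], THEN spec, THEN spec, of Z Y] by simp
qed

lemma L2_closed_subspace_square_integrable: "L2_closed_subspace M {X. square_integrable M X}"
  by (auto simp: L2_closed_subspace_def square_integrable_zero square_integrable_add square_integrable_cmult)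

text \<open>
  Closedness rests on the inequality \<open>\<bar>X D\<bar> \<le> \<epsilon> X\<^sup>2 + D\<^sup>2 / \<epsilon>\<close>, which for arbitrary \<open>\<epsilon> > 0\<close> does
  the work of the Cauchy-Schwarz inequality.
\<close>

lemma L2_closed_subspace_orthogonal:
  fixes X :: "'a \<Rightarrow> real"
  assumes X: "square_integrable M X"
  shows "L2_closed_subspace M {Z. square_integrable M Z \<and> (\<integral>\<omega>. X \<omega> * Z \<omega> \<partial>M) = 0}"
    (is "L2_closed_subspace M ?V")
  unfolding L2_closed_subspace_def
proof (intro conjI allI ballI impI)
  fix Z Y assume "Z \<in> ?V" "Y \<in> ?V"
  then show "(\<lambda>\<omega>. Z \<omega> + Y \<omega>) \<in> ?V"
    using square_integrable_mult[OF X] by (simp add: square_integrable_add distrib_left)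
next
  fix c Z assume "Z \<in> ?V"
  moreover have "(\<integral>\<omega>. X \<omega> * (c * Z \<omega>) \<partial>M) = c * (\<integral>\<omega>. X \<omega> * Z \<omega> \<partial>M)"
    by (simp add: mult.left_commute[of _ c] )
  ultimately show "(\<lambda>\<omega>. c * Z \<omega>) \<in> ?V"
    by (simp add: square_integrable_cmult)
next
  fix Z Y assume *: "(\<forall>n. Z n \<in> ?V) \<and> square_integrable M Y \<and>
        (\<lambda>n::nat. \<integral>\<omega>. (Z n \<omega> - Y \<omega>)\<^sup>2 \<partial>M) \<longlonglongrightarrow> 0"
  then have Y: "square_integrable M Y" and Z: "\<And>n. square_integrable M (Z n)"
    and orth: "\<And>n. (\<integral>\<omega>. X \<omega> * Z n \<omega> \<partial>M) = 0" by auto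
  have XX: "integrable M (\<lambda>\<omega>. (X \<omega>)\<^sup>2)" using X by (simp add: square_integrable_real_iff)
  define a where "a = (\<integral>\<omega>. (X \<omega>)\<^sup>2 \<partial>M)"
  define c where "c = \<bar>\<integral>\<omega>. X \<omega> * Y \<omega> \<partial>M\<bar>"
  have bound: "c \<le> \<epsilon> * a + (\<integral>\<omega>. (Z n \<omega> - Y \<omega>)\<^sup>2 \<partial>M) / \<epsilon>" if "\<epsilon> > 0" for \<epsilon> n
  proof -
    have D: "square_integrable M (\<lambda>\<omega>. Z n \<omega> - Y \<omega>)"
      by (intro square_integrable_diff Z Y)
    have "(\<integral>\<omega>. X \<omega> * (Z n \<omega> - Y \<omega>) \<partial>M) = - (\<integral>\<omega>. X \<omega> * Y \<omega> \<partial>M)"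
      using square_integrable_mult[OF X Y] square_integrable_mult[OF X Z] orth
      by (simp add: right_diff_distrib)
    then have "c \<le> (\<integral>\<omega>. \<bar>X \<omega> * (Z n \<omega> - Y \<omega>)\<bar> \<partial>M)"
      unfolding c_def by (metis abs_minus_cancel integral_abs_bound)
    also have "\<dots> \<le> (\<integral>\<omega>. \<epsilon> * (X \<omega>)\<^sup>2 + (Z n \<omega> - Y \<omega>)\<^sup>2 / \<epsilon> \<partial>M)"
    proof (rule integral_mono)
      show "integrable M (\<lambda>\<omega>. \<bar>X \<omega> * (Z n \<omega> - Y \<omega>)\<bar>)"
        using square_integrable_mult[OF X D] by (rule integrable_abs)
      show "integrable M (\<lambda>\<omega>. \<epsilon> * (X \<omega>)\<^sup>2 + (Z n \<omega> - Y \<omega>)\<^sup>2 / \<epsilon>)"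
        using XX D by (auto simp: square_integrable_real_iff)
      fix \<omega>
      have "2 * \<epsilon> * \<bar>X \<omega>\<bar> * \<bar>Z n \<omega> - Y \<omega>\<bar> \<le> (\<epsilon> * \<bar>X \<omega>\<bar>)\<^sup>2 + \<bar>Z n \<omega> - Y \<omega>\<bar>\<^sup>2"
        using sum_squares_bound[of "\<epsilon> * \<bar>X \<omega>\<bar>" "\<bar>Z n \<omega> - Y \<omega>\<bar>"] by (simp add: mult_ac)
      then have "2 * (\<epsilon> * \<bar>X \<omega> * (Z n \<omega> - Y \<omega>)\<bar>) \<le> \<epsilon>\<^sup>2 * (X \<omega>)\<^sup>2 + (Z n \<omega> - Y \<omega>)\<^sup>2"
        by (simp add: abs_mult power_mult_distrib mult_ac)
      moreover have "0 \<le> \<epsilon> * \<bar>X \<omega> * (Z n \<omega> - Y \<omega>)\<bar>" using that by simp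
      ultimately have "\<epsilon> * \<bar>X \<omega> * (Z n \<omega> - Y \<omega>)\<bar> \<le> \<epsilon>\<^sup>2 * (X \<omega>)\<^sup>2 + (Z n \<omega> - Y \<omega>)\<^sup>2"
        by linarith
      then show "\<bar>X \<omega> * (Z n \<omega> - Y \<omega>)\<bar> \<le> \<epsilon> * (X \<omega>)\<^sup>2 + (Z n \<omega> - Y \<omega>)\<^sup>2 / \<epsilon>"
        using that by (simp add: field_simps power2_eq_square)
    qed
    also have "\<dots> = \<epsilon> * a + (\<integral>\<omega>. (Z n \<omega> - Y \<omega>)\<^sup>2 \<partial>M) / \<epsilon>"
      using XX D by (simp add: a_def square_integrable_real_iff)
    finally show ?thesis .
  qed
  have "c \<le> \<epsilon> * a" if "\<epsilon> > 0" for \<epsilon>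
  proof (rule LIMSEQ_le_const)
    show "(\<lambda>n. \<epsilon> * a + (\<integral>\<omega>. (Z n \<omega> - Y \<omega>)\<^sup>2 \<partial>M) / \<epsilon>) \<longlonglongrightarrow> \<epsilon> * a"
      using tendsto_add[OF tendsto_const tendsto_divide[OF conjunct2[OF conjunct2[OF *]] tendsto_const], of \<epsilon> "\<epsilon> * a"] that
      by simp
  qed (use bound[OF that] in blast)
  then have "c \<le> 0"
  proof -
    assume le: "\<And>\<epsilon>. \<epsilon> > 0 \<Longrightarrow> c \<le> \<epsilon> * a"
    have "a \<ge> 0" by (simp add: a_def)
    show ?thesis
    proof (rule field_le_epsilon)
      fix e :: real assume "e > 0"
      have "c \<le> e / (a + 1) * a" using \<open>a \<ge> 0\<close> \<open>e > 0\<close> by (intro le) simp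
      also have "\<dots> \<le> e" using \<open>a \<ge> 0\<close> \<open>e > 0\<close> by (simp add: field_simps)
      finally show "c \<le> 0 + e" by simp
    qed
  qed
  then show "Y \<in> ?V" using Y by (simp add: c_def)
qed (auto simp: square_integrable_zero)

lemma L2_closed_subspace_span:
  assumes "\<And>X. X \<in> S \<Longrightarrow> square_integrable M X"
  shows "L2_closed_subspace M (L2_closed_span M S)"
proof -
  show ?thesis
    unfolding L2_closed_subspace_def
  proof (intro conjI allI ballI impI)
    have "L2_closed_span M S \<subseteq> {X. square_integrable M X}"
      unfolding L2_closed_span_def using L2_closed_subspace_square_integrable[of M] assms
      by (intro Inter_lower) auto
    then show "square_integrable M X" if "X \<in> L2_closed_span M S" for X
      using that by blast
  next
    show "(\<lambda>_. 0) \<in> L2_closed_span M S"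
      unfolding L2_closed_span_def by (blast intro: L2_closed_subspaceD_zero)
  next
    fix X Y assume "X \<in> L2_closed_span M S" "Y \<in> L2_closed_span M S"
    then show "(\<lambda>\<omega>. X \<omega> + Y \<omega>) \<in> L2_closed_span M S"
      unfolding L2_closed_span_def
      by (blast intro: L2_closed_subspaceD_add)
  next
    fix c X assume "X \<in> L2_closed_span M S"
    then show "(\<lambda>\<omega>. c * X \<omega>) \<in> L2_closed_span M S"
      unfolding L2_closed_span_def
      by (blast intro: L2_closed_subspaceD_cmult)
  next
    fix X Y assume *: "(\<forall>n. X n \<in> L2_closed_span M S) \<and> square_integrable M Y \<and>
        (\<lambda>n::nat. \<integral>\<omega>. (X n \<omega> - Y \<omega>)\<^sup>2 \<partial>M) \<longlonglongrightarrow> 0"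
    show "Y \<in> L2_closed_span M S"
      unfolding L2_closed_span_def
    proof
      fix V assume V: "V \<in> {V. L2_closed_subspace M V \<and> S \<subseteq> V}"
      then have VM: "L2_closed_subspace M V" by simp
      have "L2_closed_span M S \<subseteq> V"
        unfolding L2_closed_span_def using V by (rule Inter_lower)
      then have "X n \<in> V" for n using conjunct1[OF *] by (meson subsetD)
      then show "Y \<in> V"
        using L2_closed_subspaceD_limit[OF VM _ conjunct1[OF conjunct2[OF *]] conjunct2[OF conjunct2[OF *]]]
        by simp
    qed
  qed
qed

lemma L2_closed_span_superset: "S \<subseteq> L2_closed_span M S"
  by (auto simp: L2_closed_span_def)

lemma L2_closed_span_subset: "L2_closed_subspace M V \<Longrightarrow> S \<subseteq> V \<Longrightarrow> L2_closed_span M S \<subseteq> V"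
  by (auto simp: L2_closed_span_def)

lemma L2_closed_subspace_sum:
  assumes V: "L2_closed_subspace M V" and f: "\<And>i. i \<in> I \<Longrightarrow> f i \<in> V"
  shows "(\<lambda>\<omega>. \<Sum>i\<in>I. f i \<omega>) \<in> V"
  using f
proof (induction I rule: infinite_finite_induct)
  case (insert i I)
  have "(\<lambda>\<omega>. f i \<omega> + (\<Sum>i\<in>I. f i \<omega>)) \<in> V"
    by (intro L2_closed_subspaceD_add[OF V] insert) (simp_all add: insert)
  then show ?case using insert.hyps by simp
qed (simp_all add: L2_closed_subspaceD_zero[OF V])

text \<open>
  The limit clause, applied to a constant sequence, makes closed subspaces insensitive to almost
  sure equality.
\<close>

lemma L2_closed_subspace_AE:
  assumes V: "L2_closed_subspace M V" and X: "X \<in> V"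
    and Y: "Y \<in> borel_measurable M" and eq: "AE \<omega> in M. X \<omega> = Y \<omega>"
  shows "Y \<in> V"
proof -
  have sX: "square_integrable M X" by (rule L2_closed_subspaceD_square_integrable[OF V X])
  then have [measurable]: "X \<in> borel_measurable M" by (simp add: square_integrable_real_iff)
  note [measurable] = Y
  have "integrable M (\<lambda>\<omega>. (X \<omega>)\<^sup>2) \<longleftrightarrow> integrable M (\<lambda>\<omega>. (Y \<omega>)\<^sup>2)"
    using eq by (intro Bochner_Integration.integrable_cong_AE) auto
  then have sY: "square_integrable M Y"
    using sX Y by (simp add: square_integrable_real_iff)
  have zero: "(\<integral>\<omega>. (X \<omega> - Y \<omega>)\<^sup>2 \<partial>M) = 0"
    using eq by (intro integral_eq_zero_AE) auto
  show ?thesis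
  proof (rule L2_closed_subspaceD_limit[OF V X sY])
    show "(\<lambda>n::nat. \<integral>\<omega>. (X \<omega> - Y \<omega>)\<^sup>2 \<partial>M) \<longlonglongrightarrow> 0"
      unfolding zero by (rule tendsto_const)
  qed
qed

lemma square_integrable_AE_cong:
  fixes X Y :: "'a \<Rightarrow> real"
  assumes "square_integrable M X" "Y \<in> borel_measurable M" "AE \<omega> in M. X \<omega> = Y \<omega>"
  shows "square_integrable M Y"
  using L2_closed_subspace_AE[OF L2_closed_subspace_square_integrable, of X M Y] assms by simp

text \<open>
  The orthogonality characterization of the projection. Its existence is witnessed by \<open>P\<close>, so the
  choice in \<open>lin_proj\<close> does satisfy its specification, and the difference of two versions lies in
  the subspace and is orthogonal to itself.
\<close>

lemma lin_proj_AE_eq: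
  assumes S: "\<And>Z. Z \<in> S \<Longrightarrow> square_integrable M Z"
    and X: "square_integrable M X"
    and P: "P \<in> L2_closed_span M S"
    and orth: "\<And>Z. Z \<in> S \<Longrightarrow> (\<integral>\<omega>. (X \<omega> - P \<omega>) * Z \<omega> \<partial>M) = 0"
  shows "AE \<omega> in M. lin_proj M S X \<omega> = P \<omega>"
proof -
  let ?V = "L2_closed_span M S"
  define Q where "Q = lin_proj M S X"
  have V: "L2_closed_subspace M ?V" by (rule L2_closed_subspace_span[OF S])
  have sq: "square_integrable M Z" if "Z \<in> ?V" for Z
    by (rule L2_closed_subspaceD_square_integrable[OF V that])
  have XP: "square_integrable M (\<lambda>\<omega>. X \<omega> - P \<omega>)"
    by (rule square_integrable_diff[OF X sq[OF P]])
  have "?V \<subseteq> {Z. square_integrable M Z \<and> (\<integral>\<omega>. (X \<omega> - P \<omega>) * Z \<omega> \<partial>M) = 0}"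
    by (rule L2_closed_span_subset[OF L2_closed_subspace_orthogonal[OF XP]]) (auto simp: S orth)
  then have P_orth: "\<forall>Z\<in>?V. (\<integral>\<omega>. (X \<omega> - P \<omega>) * Z \<omega> \<partial>M) = 0" by blast
  have "Q \<in> ?V \<and> (\<forall>Z\<in>?V. (\<integral>\<omega>. (X \<omega> - Q \<omega>) * Z \<omega> \<partial>M) = 0)"
    unfolding Q_def lin_proj_def by (rule someI[of _ P]) (rule conjI[OF P P_orth])
  then have Q: "Q \<in> ?V" and Q_orth: "\<And>Z. Z \<in> ?V \<Longrightarrow> (\<integral>\<omega>. (X \<omega> - Q \<omega>) * Z \<omega> \<partial>M) = 0"
    by blast+
  define D where "D = (\<lambda>\<omega>. Q \<omega> - P \<omega>)"
  have "(\<lambda>\<omega>. Q \<omega> + (-1) * P \<omega>) \<in> ?V"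
    by (intro L2_closed_subspaceD_add[OF V] L2_closed_subspaceD_cmult[OF V] P Q)
  then have D: "D \<in> ?V" by (simp add: D_def)
  note int = square_integrable_mult[OF square_integrable_diff[OF X sq[OF P]] sq[OF D]]
    square_integrable_mult[OF square_integrable_diff[OF X sq[OF Q]] sq[OF D]]
  have "(\<integral>\<omega>. (D \<omega>)\<^sup>2 \<partial>M) = (\<integral>\<omega>. (X \<omega> - P \<omega>) * D \<omega> - (X \<omega> - Q \<omega>) * D \<omega> \<partial>M)"
    by (intro Bochner_Integration.integral_cong) (auto simp: D_def power2_eq_square algebra_simps)
  also have "\<dots> = 0"
    unfolding Bochner_Integration.integral_diff[OF int] using bspec[OF P_orth D] Q_orth[OF D] by simp
  finally have "(\<integral>\<omega>. (D \<omega>)\<^sup>2 \<partial>M) = 0" .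
  moreover have "integrable M (\<lambda>\<omega>. (D \<omega>)\<^sup>2)"
    using sq[OF D] by (simp add: square_integrable_real_iff)
  ultimately have "AE \<omega> in M. (D \<omega>)\<^sup>2 = 0"
    by (subst (asm) integral_nonneg_eq_0_iff_AE) auto
  then show ?thesis
    by (simp add: D_def Q_def)
qed

section \<open>Conditional independence and products\<close>

lemma space_generated_sigma [simp]: "space (generated_sigma M I X) = space M"
  by (simp add: generated_sigma_def space_measure_of_conv)

lemma sets_generated_sigma:
  "sets (generated_sigma M I X) =
     sigma_sets (space M) {X i -` B \<inter> space M | i B. i \<in> I \<and> B \<in> sets borel}"
  unfolding generated_sigma_def by (rule sets_measure_of) blast

lemma measurable_generated_sigma:
  "i \<in> I \<Longrightarrow> X i \<in> borel_measurable (generated_sigma M I X)"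
  by (rule measurableI) (auto simp: sets_generated_sigma)

lemma sets_generated_sigma_subset:
  assumes "space N = space M" "\<And>i. i \<in> I \<Longrightarrow> X i \<in> borel_measurable N"
  shows "sets (generated_sigma M I X) \<subseteq> sets N"
proof -
  have "{X i -` B \<inter> space M | i B. i \<in> I \<and> B \<in> sets borel} \<subseteq> sets N"
    using assms by (auto simp: assms(1)[symmetric] intro: measurable_sets)
  then show ?thesis
    unfolding sets_generated_sigma assms(1)[symmetric] by (rule sets.sigma_sets_subset)
qed

lemma subalgebra_generated_sigma:
  assumes "\<And>i. i \<in> I \<Longrightarrow> X i \<in> borel_measurable M"
  shows "subalgebra M (generated_sigma M I X)"
  unfolding subalgebra_def using sets_generated_sigma_subset[OF refl assms] by simp

lemma borel_measurable_vecI: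
  fixes X :: "'a \<Rightarrow> real^'n"
  assumes "\<And>i. (\<lambda>\<omega>. X \<omega> $ i) \<in> borel_measurable M"
  shows "X \<in> borel_measurable M"
proof (subst borel_measurable_euclidean_space, rule ballI)
  fix b :: "real^'n" assume "b \<in> Basis"
  then obtain i where "b = axis i 1" by (auto simp: Basis_vec_def)
  then show "(\<lambda>\<omega>. X \<omega> \<bullet> b) \<in> borel_measurable M"
    using assms[of i] by (simp add: inner_axis)
qed

text \<open>
  Reconciles two descriptions of the past of the scheduling: admissibility conditions on the
  vectors \<open>\<mu> k\<close>, conditional independence is stated for their components.
\<close>

lemma generated_sigma_components:
  fixes X :: "'i \<Rightarrow> 'a \<Rightarrow> real^'n"
  shows "generated_sigma M (I \<times> UNIV) (\<lambda>(k, \<sigma>) \<omega>. X k \<omega> $ \<sigma>) = generated_sigma M I X"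
proof -
  let ?C = "generated_sigma M (I \<times> UNIV) (\<lambda>(k, \<sigma>) \<omega>. X k \<omega> $ \<sigma>)"
  let ?V = "generated_sigma M I X"
  have "sets ?C \<subseteq> sets ?V"
  proof (rule sets_generated_sigma_subset)
    fix i :: "'i \<times> 'n" assume "i \<in> I \<times> UNIV"
    then obtain k \<sigma> where i: "i = (k, \<sigma>)" "k \<in> I" by auto
    show "(case i of (k, \<sigma>) \<Rightarrow> \<lambda>\<omega>. X k \<omega> $ \<sigma>) \<in> borel_measurable ?V"
      using borel_measurable_vec_nth[OF measurable_generated_sigma[of k I X M], of \<sigma>] i by simp
  qed simp
  moreover have "sets ?V \<subseteq> sets ?C"
  proof (rule sets_generated_sigma_subset)
    fix k assume k: "k \<in> I"
    have "(\<lambda>\<omega>. X k \<omega> $ \<sigma>) \<in> borel_measurable ?C" for \<sigma>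
      using measurable_generated_sigma[of "(k, \<sigma>)" "I \<times> UNIV" "\<lambda>(k, \<sigma>) \<omega>. X k \<omega> $ \<sigma>" M] k by simp
    then show "X k \<in> borel_measurable ?C" by (rule borel_measurable_vecI)
  qed simp
  ultimately have "sets ?C = sets ?V" by simp
  then show ?thesis
    unfolding sets_generated_sigma unfolding generated_sigma_def
    by (intro sigma_eqI) auto
qed

text \<open>
  On sets of \<open>G\<close>, the indicator of \<open>A \<inter> D\<close> and the function \<open>1\<^sub>D E[1\<^sub>A | H]\<close> have the same
  integrals, by conditional independence; so they have the same conditional expectation given \<open>G\<close>
  and may be exchanged in integrals against \<open>g\<close>. After the exchange the cofactor of \<open>g\<close> is
  \<open>H\<close>-measurable, and \<open>g\<close> may be replaced by \<open>E[g | H] = c\<close>.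
\<close>

lemma cond_indep_integral:
  fixes g :: "'a \<Rightarrow> real"
  assumes M: "prob_space M" and indep: "cond_indep_sigma M F G H"
    and F: "subalgebra M F" and G: "subalgebra M G" and H: "subalgebra M H"
    and g: "g \<in> borel_measurable G" "integrable M g"
    and c: "AE \<omega> in M. real_cond_exp M H g \<omega> = c"
    and A: "A \<in> sets F" and D: "D \<in> sets H"
  shows "(\<integral>\<omega>. indicator (A \<inter> D) \<omega> * g \<omega> \<partial>M) = c * measure M (A \<inter> D)"
proof -
  interpret prob_space M by (rule M)
  interpret G: finite_measure_subalgebra M G by unfold_locales (rule G)
  interpret H: finite_measure_subalgebra M H by unfold_locales (rule H)
  have sub: "sets F \<subseteq> sets M" "sets G \<subseteq> sets M" "sets H \<subseteq> sets M"
    using F G H by (auto simp: subalgebra_def)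
  have AM [measurable]: "A \<in> sets M" and DM [measurable]: "D \<in> sets M" using A D sub by auto
  have gM [measurable]: "g \<in> borel_measurable M" using g(2) by simp
  define a where "a = real_cond_exp M H (indicator A)"
  have aH [measurable]: "a \<in> borel_measurable H" by (simp add: a_def)
  have aM [measurable]: "a \<in> borel_measurable M" by (simp add: a_def)
  have intA: "integrable M (indicator B :: 'a \<Rightarrow> real)" if "B \<in> sets M" for B
    using that by (simp add: less_top[symmetric])
  have "AE \<omega> in M. a \<omega> \<ge> 0"
    unfolding a_def by (rule H.real_cond_exp_ge_c[OF intA[OF AM]]) simp
  moreover have "AE \<omega> in M. a \<omega> \<le> 1"
    unfolding a_def by (rule H.real_cond_exp_le_c[OF intA[OF AM]]) (simp add: indicator_le_1)
  ultimately have a01: "AE \<omega> in M. \<bar>a \<omega>\<bar> \<le> 1" by eventually_elim simp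
  define f2 where "f2 = (\<lambda>\<omega>. indicator D \<omega> * a \<omega>)"
  have f2H: "f2 \<in> borel_measurable H"
    unfolding f2_def using D by measurable
  have f2M [measurable]: "f2 \<in> borel_measurable M"
    unfolding f2_def by measurable
  have int_f2: "integrable M (\<lambda>\<omega>. f2 \<omega> * h \<omega>)" if h: "integrable M h" for h
  proof (rule Bochner_Integration.integrable_bound[OF h])
    show "(\<lambda>\<omega>. f2 \<omega> * h \<omega>) \<in> borel_measurable M"
      using h by (intro borel_measurable_times) auto
    show "AE \<omega> in M. norm (f2 \<omega> * h \<omega>) \<le> norm (h \<omega>)"
      using a01 by eventually_elim (auto simp: f2_def abs_mult indicator_def intro: mult_left_le_one_le)
  qed
  have eqG: "AE \<omega> in M. real_cond_exp M G (indicator (A \<inter> D)) \<omega> = real_cond_exp M G f2 \<omega>"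
  proof (rule G.real_cond_exp_charact)
    fix B assume B: "B \<in> sets G"
    then have BM [measurable]: "B \<in> sets M" using sub by auto
    have split: "AE \<omega> in M. real_cond_exp M H (indicator (A \<inter> B)) \<omega> = a \<omega> * real_cond_exp M H (indicator B) \<omega>"
      using indep A B unfolding cond_indep_sigma_def a_def by blast
    have iAB: "integrable M (\<lambda>\<omega>. indicator D \<omega> * indicator (A \<inter> B) \<omega> :: real)"
      using intA[of "D \<inter> (A \<inter> B)"] by (simp add: indicator_inter_arith[symmetric])
    have "(\<integral>\<omega>\<in>B. indicator (A \<inter> D) \<omega> \<partial>M) = (\<integral>\<omega>. indicator D \<omega> * indicator (A \<inter> B) \<omega> \<partial>M :: real)"
      unfolding set_lebesgue_integral_def
      by (intro Bochner_Integration.integral_cong) (auto simp: indicator_def)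
    also have "\<dots> = (\<integral>\<omega>. indicator D \<omega> * real_cond_exp M H (indicator (A \<inter> B)) \<omega> \<partial>M)"
      using D by (intro H.real_cond_exp_intg(2)[symmetric] iAB) auto
    also have "\<dots> = (\<integral>\<omega>. f2 \<omega> * real_cond_exp M H (indicator B) \<omega> \<partial>M)"
      by (rule integral_cong_AE) (use split in \<open>auto simp: f2_def\<close>)
    also have "\<dots> = (\<integral>\<omega>. f2 \<omega> * indicator B \<omega> \<partial>M)"
      by (rule H.real_cond_exp_intg(2)[OF int_f2[OF intA[OF BM]] f2H]) simp
    also have "\<dots> = (\<integral>\<omega>\<in>B. f2 \<omega> \<partial>M)"
      unfolding set_lebesgue_integral_def by (simp add: mult.commute)
    also have "\<dots> = (\<integral>\<omega>\<in>B. real_cond_exp M G f2 \<omega> \<partial>M)"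
      using int_f2[of "\<lambda>_. 1"] by (intro G.real_cond_exp_intA B) simp
    finally show "(\<integral>\<omega>\<in>B. indicator (A \<inter> D) \<omega> \<partial>M) = (\<integral>\<omega>\<in>B. real_cond_exp M G f2 \<omega> \<partial>M)" .
  next
    show "integrable M (indicator (A \<inter> D) :: 'a \<Rightarrow> real)" by (rule intA) simp
    show "integrable M (real_cond_exp M G f2)"
      using int_f2[of "\<lambda>_. 1"] by (intro G.real_cond_exp_int) simp
  qed simp
  have "(\<integral>\<omega>. indicator (A \<inter> D) \<omega> * g \<omega> \<partial>M) = (\<integral>\<omega>. g \<omega> * indicator (A \<inter> D) \<omega> \<partial>M)"
    by (simp add: mult.commute)
  also have "\<dots> = (\<integral>\<omega>. g \<omega> * real_cond_exp M G (indicator (A \<inter> D)) \<omega> \<partial>M)"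
  proof (rule G.real_cond_exp_intg(2)[symmetric])
    show "integrable M (\<lambda>\<omega>. g \<omega> * indicator (A \<inter> D) \<omega>)"
      using g(2) by (intro integrable_real_mult_indicator) auto
  qed (use g in auto)
  also have "\<dots> = (\<integral>\<omega>. g \<omega> * real_cond_exp M G f2 \<omega> \<partial>M)"
    by (rule integral_cong_AE) (use eqG in auto)
  also have "\<dots> = (\<integral>\<omega>. g \<omega> * f2 \<omega> \<partial>M)"
    using int_f2[OF g(2)] g(1) by (intro G.real_cond_exp_intg(2)) (auto simp: mult.commute)
  also have "\<dots> = (\<integral>\<omega>. f2 \<omega> * real_cond_exp M H g \<omega> \<partial>M)"
    using H.real_cond_exp_intg(2)[OF int_f2[OF g(2)] f2H gM] by (simp add: mult.commute)
  also have "\<dots> = (\<integral>\<omega>. c * (indicator D \<omega> * a \<omega>) \<partial>M)"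
    by (rule integral_cong_AE) (use c in \<open>auto simp: f2_def\<close>)
  also have "\<dots> = c * (\<integral>\<omega>. indicator D \<omega> * a \<omega> \<partial>M)"
    by (rule integral_mult_right_zero)
  also have "(\<integral>\<omega>. indicator D \<omega> * a \<omega> \<partial>M) = (\<integral>\<omega>. indicator D \<omega> * indicator A \<omega> \<partial>M)"
    unfolding a_def using D intA[of "D \<inter> A"]
    by (intro H.real_cond_exp_intg(2)) (auto simp: indicator_inter_arith[symmetric])
  also have "\<dots> = measure M (A \<inter> D)"
    using sets.sets_into_space[OF AM]
    by (simp add: indicator_inter_arith[symmetric] Int_commute Int_absorb2 le_infI1)
  finally show ?thesis .
qed

text \<open>
  The constant \<open>c\<close> is the conditional expectation of \<open>g\<close> even given \<open>F\<close> and \<open>H\<close> together: the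
  previous lemma checks this on the sets \<open>A \<inter> D\<close>, which form an intersection-stable generator. The
  \<open>\<sigma>\<close>-algebra generated by both accommodates functions \<open>f\<close> such as products of a state variable
  and scheduling factors, where only the whole product is known to be integrable.
\<close>

lemma cond_indep_integral_mult:
  fixes f g :: "'a \<Rightarrow> real"
  assumes M: "prob_space M" and indep: "cond_indep_sigma M F G H"
    and F: "subalgebra M F" and G: "subalgebra M G" and H: "subalgebra M H"
    and g: "g \<in> borel_measurable G" "integrable M g"
    and c: "AE \<omega> in M. real_cond_exp M H g \<omega> = c"
    and f: "f \<in> borel_measurable (sigma (space M) (sets F \<union> sets H))"
    and fg: "integrable M (\<lambda>\<omega>. f \<omega> * g \<omega>)"
  shows "(\<integral>\<omega>. f \<omega> * g \<omega> \<partial>M) = c * (\<integral>\<omega>. f \<omega> \<partial>M)"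
proof -
  interpret prob_space M by (rule M)
  let ?E = "{A \<inter> D | A D. A \<in> sets F \<and> D \<in> sets H}"
  let ?J = "sigma (space M) (sets F \<union> sets H)"
  have sp: "space F = space M" "space H = space M" and sub: "sets F \<subseteq> sets M" "sets H \<subseteq> sets M"
    using F H by (auto simp: subalgebra_def)
  have FH: "sets F \<union> sets H \<subseteq> Pow (space M)" using sub sets.space_closed by blast
  have setsJ: "sets ?J = sigma_sets (space M) (sets F \<union> sets H)"
    by (rule sets_measure_of[OF FH])
  have J: "subalgebra M ?J"
    unfolding subalgebra_def setsJ using sub by (auto simp: space_measure_of_conv intro!: sets.sigma_sets_subset)
  interpret J: finite_measure_subalgebra M ?J by unfold_locales (rule J)
  have E_sub: "?E \<subseteq> Pow (space M)" using FH by auto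
  have JE: "sigma_sets (space M) (sets F \<union> sets H) = sigma_sets (space M) ?E"
  proof (rule sigma_sets_eqI)
    fix A assume "A \<in> sets F \<union> sets H"
    then have "A \<in> ?E"
    proof
      assume "A \<in> sets F"
      moreover from this have "A = A \<inter> space H" using sets.sets_into_space[of A F] sp by auto
      ultimately show ?thesis by blast
    next
      assume "A \<in> sets H"
      moreover from this have "A = space F \<inter> A" using sets.sets_into_space[of A H] sp by auto
      ultimately show ?thesis by blast
    qed
    then show "A \<in> sigma_sets (space M) ?E" by (rule sigma_sets.Basic)
  next
    fix B assume "B \<in> ?E"
    then obtain A D where "B = A \<inter> D" "A \<in> sets F" "D \<in> sets H" by auto
    then show "B \<in> sigma_sets (space M) (sets F \<union> sets H)"
      using sets.Int[of A ?J D] unfolding setsJ by auto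
  qed
  have stable: "Int_stable ?E"
  proof (rule Int_stableI)
    fix a b assume "a \<in> ?E" "b \<in> ?E"
    then obtain A D A' D' where "a = A \<inter> D" "b = A' \<inter> D'" "A \<in> sets F" "D \<in> sets H" "A' \<in> sets F" "D' \<in> sets H"
      by auto
    moreover from this have "a \<inter> b = (A \<inter> A') \<inter> (D \<inter> D')" by auto
    ultimately show "a \<inter> b \<in> ?E" by blast
  qed
  have gM [measurable]: "g \<in> borel_measurable M" using g by simp
  have int_g: "integrable M (\<lambda>\<omega>. indicator B \<omega> * g \<omega>)" if "B \<in> sets M" for B
    using integrable_real_mult_indicator[OF that g(2)] by (simp add: mult.commute)
  have on_sets: "(\<integral>\<omega>. indicator B \<omega> * g \<omega> \<partial>M) = c * measure M B"
    if "B \<in> sigma_sets (space M) ?E" for B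
    using stable E_sub that
  proof (induction rule: sigma_sets_induct_disjoint)
    case (basic A)
    then show ?case using cond_indep_integral[OF M indep F G H g c] by auto
  next
    case empty
    show ?case by simp
  next
    case (compl A)
    have AM: "A \<in> sets M"
      using compl(1) J unfolding subalgebra_def setsJ JE by blast
    have top: "(\<integral>\<omega>. indicator (space M) \<omega> * g \<omega> \<partial>M) = c * measure M (space M)"
      using cond_indep_integral[OF M indep F G H g c sets.top sets.top] sp by simp
    have "(\<integral>\<omega>. indicator (space M - A) \<omega> * g \<omega> \<partial>M) =
        (\<integral>\<omega>. indicator (space M) \<omega> * g \<omega> - indicator A \<omega> * g \<omega> \<partial>M)"
      using sets.sets_into_space[OF AM]
      by (intro Bochner_Integration.integral_cong) (auto simp: indicator_def)
    also have "\<dots> = c * measure M (space M) - c * measure M A"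
      using int_g[OF AM] int_g[OF sets.top] top compl(2) by simp
    also have "\<dots> = c * measure M (space M - A)"
      using AM by (simp add: prob_compl prob_space algebra_simps)
    finally show ?case .
  next
    case (union A)
    have AM: "\<And>i. A i \<in> sets M"
      using union(2) J unfolding subalgebra_def setsJ JE by blast
    have "(\<integral>\<omega>\<in>(\<Union>i. A i). g \<omega> \<partial>M) = (\<Sum>i. \<integral>\<omega>\<in>A i. g \<omega> \<partial>M)"
      using AM union(1) int_g[of "\<Union>i. A i"]
      by (intro lebesgue_integral_countable_add) (auto simp: set_integrable_def disjoint_family_on_def)
    also have "\<dots> = (\<Sum>i. c * measure M (A i))"
      using union(3) by (simp add: set_lebesgue_integral_def)
    also have "\<dots> = c * measure M (\<Union>i. A i)"
      using AM union(1) by (intro sums_unique[symmetric] sums_mult finite_measure_UNION) auto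
    finally show ?case
      by (simp add: set_lebesgue_integral_def)
  qed
  have ceJ: "AE \<omega> in M. real_cond_exp M ?J g \<omega> = c"
  proof (rule J.real_cond_exp_charact)
    fix B assume B: "B \<in> sets ?J"
    then have "B \<in> sets M" using J by (auto simp: subalgebra_def)
    then show "(\<integral>\<omega>\<in>B. g \<omega> \<partial>M) = (\<integral>\<omega>\<in>B. c \<partial>M)"
      using on_sets[of B] B unfolding setsJ JE set_lebesgue_integral_def
      by (simp add: mult.commute)
  qed (use g in auto)
  have "(\<integral>\<omega>. f \<omega> * g \<omega> \<partial>M) = (\<integral>\<omega>. f \<omega> * real_cond_exp M ?J g \<omega> \<partial>M)"
    using J.real_cond_exp_intg(2)[OF fg f gM] by simp
  also have "\<dots> = (\<integral>\<omega>. c * f \<omega> \<partial>M)"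
    by (rule integral_cong_AE)
      (use ceJ measurable_from_subalg[OF J f] in \<open>auto simp: mult.commute\<close>)
  finally show ?thesis by simp
qed

section \<open>Second moments of the scheduling given the joint past\<close>

lemma sched_prod_Nil [simp]: "sched_prod \<mu> [] t \<omega> = 1"
  by (simp add: sched_prod_def)

lemma sched_prod_Cons:
  "sched_prod \<mu> (\<sigma> # w) t \<omega> = \<mu> (t - int (length w)) \<omega> $ \<sigma> * sched_prod \<mu> w t \<omega>"
  unfolding sched_prod_def
  by (simp add: prod.lessThan_Suc_shift algebra_simps del: prod.lessThan_Suc)

lemma zproc_nth:
  "zproc \<mu> p r w t \<omega> $ j =
     (1 / sqrt (word_weight p w)) * (sched_prod \<mu> w (t - 1) \<omega> * r (t - int (length w)) \<omega> $ j)"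
  by (simp add: zproc_def)

lemma word_weight_pos: "(\<And>\<sigma>. p \<sigma> > 0) \<Longrightarrow> word_weight p w > 0"
  by (induction w) (simp_all add: word_weight_def)

lemma sched_prod_eq_zproc:
  assumes "\<And>\<sigma>. p \<sigma> > 0"
  shows "sched_prod \<mu> w (t + int (length w) - 1) \<omega> * r t \<omega> $ j =
    sqrt (word_weight p w) * zproc \<mu> p r w (t + int (length w)) \<omega> $ j"
  using word_weight_pos[of p w, OF assms] by (simp add: zproc_nth)

lemma
  assumes "admissible M \<mu> p"
  shows admissible_measurable: "\<mu> t \<in> borel_measurable M"
    and admissible_pos: "p \<sigma> > 0"
    and admissible_cond_exp_word_letter: "w \<noteq> [] \<Longrightarrow> AE \<omega> in M.
        real_cond_exp M (sched_past M \<mu> t)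
          (\<lambda>\<omega>. sched_prod \<mu> (w @ [\<sigma>]) t \<omega> * \<mu> t \<omega> $ \<sigma>) \<omega> = p \<sigma> * sched_prod \<mu> w (t - 1) \<omega>"
    and admissible_cond_exp_distinct_letters: "\<sigma> \<noteq> \<sigma>' \<Longrightarrow> AE \<omega> in M.
        real_cond_exp M (sched_past M \<mu> t) (\<lambda>\<omega>. \<mu> t \<omega> $ \<sigma> * \<mu> t \<omega> $ \<sigma>') \<omega> = 0"
    and admissible_partition_of_unity: "\<exists>\<alpha>. \<forall>t. AE \<omega> in M. (\<Sum>\<sigma>\<in>UNIV. \<alpha> \<sigma> * \<mu> t \<omega> $ \<sigma>) = 1"
    and admissible_square_integrable: "w \<noteq> [] \<Longrightarrow> square_integrable M (sched_prod \<mu> w t)"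
proof -
  note adm = assms[unfolded admissible_def]
  note adm2 = conjunct2[OF conjunct2[OF conjunct2[OF adm]]]
  note adm3 = conjunct2[OF conjunct2[OF adm2]]
  show "\<mu> t \<in> borel_measurable M" by (rule spec[OF conjunct1[OF adm]])
  show "p \<sigma> > 0" by (rule spec[OF conjunct1[OF conjunct2[OF adm]]])
  show "AE \<omega> in M. real_cond_exp M (sched_past M \<mu> t)
          (\<lambda>\<omega>. sched_prod \<mu> (w @ [\<sigma>]) t \<omega> * \<mu> t \<omega> $ \<sigma>) \<omega> = p \<sigma> * sched_prod \<mu> w (t - 1) \<omega>"
    if "w \<noteq> []"
    using mp[OF conjunct1[OF adm2, THEN spec[where x=w], THEN spec[where x=\<sigma>],
        THEN spec[where x=\<sigma>], THEN spec[where x=t]] that]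
    by (simp only: simp_thms if_True)
  show "AE \<omega> in M. real_cond_exp M (sched_past M \<mu> t) (\<lambda>\<omega>. \<mu> t \<omega> $ \<sigma> * \<mu> t \<omega> $ \<sigma>') \<omega> = 0"
    if "\<sigma> \<noteq> \<sigma>'"
    by (rule mp[OF conjunct1[OF conjunct2[OF adm2], THEN spec, THEN spec, THEN spec] that])
  show "\<exists>\<alpha>. \<forall>t. AE \<omega> in M. (\<Sum>\<sigma>\<in>UNIV. \<alpha> \<sigma> * \<mu> t \<omega> $ \<sigma>) = 1"
    by (rule conjunct1[OF adm3])
  show "square_integrable M (sched_prod \<mu> w t)" if "w \<noteq> []"
  proof -
    have "wide_sense_stationary M
       (\<lambda>t \<omega>. vector [sched_prod \<mu> w t \<omega>, sched_prod \<mu> w t \<omega>] :: real^2)"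
      by (rule mp[OF conjunct2[OF adm3, THEN spec, THEN spec] conjI[OF that that]])
    then have "square_integrable M (\<lambda>\<omega>. vector [sched_prod \<mu> w t \<omega>, sched_prod \<mu> w t \<omega>] :: real^2)"
      unfolding wide_sense_stationary_def by (rule spec[OF conjunct1])
    from square_integrable_nth[OF this, of 1] show ?thesis by simp
  qed
qed

lemma subalgebra_sched_past:
  "admissible M \<mu> p \<Longrightarrow> subalgebra M (sched_past M \<mu> t)"
  unfolding sched_past_def by (intro subalgebra_generated_sigma admissible_measurable)

text \<open>
  For \<open>\<sigma> = \<sigma>'\<close> admissibility prescribes the conditional mean of \<open>\<mu>\<^sub>\<tau> (t - 1) (\<mu>\<^sub>\<sigma> t)\<^sup>2\<close> only in the
  presence of an earlier letter \<open>\<tau>\<close>. Averaging over \<open>\<tau>\<close> with the weights \<open>\<alpha>\<^sub>\<tau>\<close> removes that letter,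
  because \<open>\<Sum>\<tau>. \<alpha>\<^sub>\<tau> \<mu>\<^sub>\<tau> (t - 1) = 1\<close>.
\<close>

lemma admissible_second_moment:
  assumes M: "prob_space M" and adm: "admissible M \<mu> p"
  shows "AE \<omega> in M. real_cond_exp M (sched_past M \<mu> t) (\<lambda>\<omega>. \<mu> t \<omega> $ \<sigma> * \<mu> t \<omega> $ \<sigma>') \<omega>
    = (if \<sigma> = \<sigma>' then p \<sigma> else 0)"
proof (cases "\<sigma> = \<sigma>'")
  case False
  then show ?thesis using admissible_cond_exp_distinct_letters[OF adm, of \<sigma> \<sigma>' t] by simp
next
  case True
  interpret prob_space M by (rule M)
  interpret H: finite_measure_subalgebra M "sched_past M \<mu> t"
    by unfold_locales (rule subalgebra_sched_past[OF adm])
  obtain \<alpha> where \<alpha>: "\<And>t. AE \<omega> in M. (\<Sum>\<sigma>\<in>UNIV. \<alpha> \<sigma> * \<mu> t \<omega> $ \<sigma>) = 1"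
    using admissible_partition_of_unity[OF adm] by blast
  have [measurable]: "(\<lambda>\<omega>. \<mu> t \<omega> $ \<sigma>) \<in> borel_measurable M" for t \<sigma>
    by (intro borel_measurable_vec_nth admissible_measurable[OF adm])
  define h where "h = (\<lambda>\<tau> \<omega>. sched_prod \<mu> ([\<tau>] @ [\<sigma>]) t \<omega> * \<mu> t \<omega> $ \<sigma>)"
  have h: "h \<tau> \<omega> = \<mu> (t - 1) \<omega> $ \<tau> * (\<mu> t \<omega> $ \<sigma> * \<mu> t \<omega> $ \<sigma>)" for \<tau> \<omega>
    by (simp add: h_def sched_prod_Cons)
  have int_h: "integrable M (h \<tau>)" for \<tau>
    using square_integrable_mult[OF admissible_square_integrable[OF adm, of "[\<tau>, \<sigma>]" t]
        admissible_square_integrable[OF adm, of "[\<sigma>]" t]]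
    by (simp add: h_def sched_prod_Cons)
  have [measurable]: "h \<tau> \<in> borel_measurable M" for \<tau>
    using int_h by simp
  have ce_h: "AE \<omega> in M. real_cond_exp M (sched_past M \<mu> t) (h \<tau>) \<omega> = p \<sigma> * \<mu> (t - 1) \<omega> $ \<tau>" for \<tau>
    using admissible_cond_exp_word_letter[OF adm, of "[\<tau>]" t \<sigma>] by (simp add: h_def sched_prod_Cons)
  have ce_ch: "AE \<omega> in M. real_cond_exp M (sched_past M \<mu> t) (\<lambda>\<omega>. \<alpha> \<tau> * h \<tau> \<omega>) \<omega> = \<alpha> \<tau> * (p \<sigma> * \<mu> (t - 1) \<omega> $ \<tau>)" for \<tau>
    using H.real_cond_exp_cmult[OF int_h[of \<tau>], of "\<alpha> \<tau>"] ce_h[of \<tau>] by eventually_elim simp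
  have "AE \<omega> in M. real_cond_exp M (sched_past M \<mu> t) (\<lambda>\<omega>. \<mu> t \<omega> $ \<sigma> * \<mu> t \<omega> $ \<sigma>) \<omega>
      = real_cond_exp M (sched_past M \<mu> t) (\<lambda>\<omega>. \<Sum>\<tau>\<in>UNIV. \<alpha> \<tau> * h \<tau> \<omega>) \<omega>"
  proof (rule H.real_cond_exp_cong)
    show "AE \<omega> in M. \<mu> t \<omega> $ \<sigma> * \<mu> t \<omega> $ \<sigma> = (\<Sum>\<tau>\<in>UNIV. \<alpha> \<tau> * h \<tau> \<omega>)"
      using \<alpha>[of "t - 1"]
    proof eventually_elim
      case (elim \<omega>)
      have "(\<Sum>\<tau>\<in>UNIV. \<alpha> \<tau> * h \<tau> \<omega>) = (\<Sum>\<tau>\<in>UNIV. \<alpha> \<tau> * \<mu> (t - 1) \<omega> $ \<tau>) * (\<mu> t \<omega> $ \<sigma> * \<mu> t \<omega> $ \<sigma>)"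
        unfolding sum_distrib_right h by (simp add: mult.assoc)
      then show ?case using elim by simp
    qed
  qed measurable
  moreover have "AE \<omega> in M. real_cond_exp M (sched_past M \<mu> t) (\<lambda>\<omega>. \<Sum>\<tau>\<in>UNIV. \<alpha> \<tau> * h \<tau> \<omega>) \<omega>
      = (\<Sum>\<tau>\<in>UNIV. real_cond_exp M (sched_past M \<mu> t) (\<lambda>\<omega>. \<alpha> \<tau> * h \<tau> \<omega>) \<omega>)"
    using int_h by (intro H.real_cond_exp_sum) auto
  moreover have "AE \<omega> in M. \<forall>\<tau>\<in>UNIV. real_cond_exp M (sched_past M \<mu> t) (\<lambda>\<omega>. \<alpha> \<tau> * h \<tau> \<omega>) \<omega>
      = \<alpha> \<tau> * (p \<sigma> * \<mu> (t - 1) \<omega> $ \<tau>)"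
    using ce_ch by (intro AE_finite_allI) auto
  ultimately show ?thesis
    using \<alpha>[of "t - 1"]
  proof eventually_elim
    case (elim \<omega>)
    have "(\<Sum>\<tau>\<in>UNIV. \<alpha> \<tau> * (p \<sigma> * \<mu> (t - 1) \<omega> $ \<tau>)) = p \<sigma> * (\<Sum>\<tau>\<in>UNIV. \<alpha> \<tau> * \<mu> (t - 1) \<omega> $ \<tau>)"
      by (simp add: sum_distrib_left mult.left_commute)
    with elim True show ?case by simp
  qed
qed

lemma
  assumes "ZMWSII M \<mu> p r"
  shows ZMWSII_square_integrable: "square_integrable M (r t)"
    and ZMWSII_square_integrable_zproc: "w \<noteq> [] \<Longrightarrow> square_integrable M (zproc \<mu> p r w t)"
    and ZMWSII_cross_moment: "cross_moment M (r (t + k)) (r (s + k)) = cross_moment M (r t) (r s)"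
proof -
  note r = conjunct2[OF assms[unfolded ZMWSII_def]]
  show "square_integrable M (r t)"
    by (rule conjunct1[OF spec[OF conjunct1[OF r]]])
  show "square_integrable M (zproc \<mu> p r w t)" if "w \<noteq> []"
    by (rule conjunct1[OF mp[OF conjunct1[OF conjunct2[OF r], THEN spec, THEN spec] that]])
  show "cross_moment M (r (t + k)) (r (s + k)) = cross_moment M (r t) (r s)"
    by (rule conjunct1[OF conjunct2[OF conjunct2[OF r]], THEN spec, THEN spec, THEN spec])
qed

text \<open>
  The process is known up to and including time \<open>t\<close>, the scheduling strictly before \<open>t\<close>: this is
  the information available when \<open>\<mu> t\<close> is drawn.
\<close>

definition joint_past :: "'a measure \<Rightarrow> (int \<Rightarrow> 'a \<Rightarrow> real^'s) \<Rightarrow> (int \<Rightarrow> 'a \<Rightarrow> real^'n) \<Rightarrow> int \<Rightarrow> 'a measure" where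
  "joint_past M \<mu> r t =
     sigma (space M) (sets (generated_sigma M {..t} r) \<union> sets (sched_past M \<mu> t))"

lemma sets_joint_past:
  "sets (joint_past M \<mu> r t) =
    sigma_sets (space M) (sets (generated_sigma M {..t} r) \<union> sets (sched_past M \<mu> t))"
  unfolding joint_past_def
proof (rule sets_measure_of)
  show "sets (generated_sigma M {..t} r) \<union> sets (sched_past M \<mu> t) \<subseteq> Pow (space M)"
    using sets.space_closed[of "generated_sigma M {..t} r"] sets.space_closed[of "sched_past M \<mu> t"]
    by (simp add: sched_past_def)
qed

lemma space_joint_past [simp]: "space (joint_past M \<mu> r t) = space M"
  by (simp add: joint_past_def space_measure_of_conv)

lemma measurable_joint_past_process:
  assumes "k \<le> t"
  shows "r k \<in> borel_measurable (joint_past M \<mu> r t)"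
proof (rule measurable_from_subalg)
  show "subalgebra (joint_past M \<mu> r t) (generated_sigma M {..t} r)"
    by (auto simp: subalgebra_def sets_joint_past)
  show "r k \<in> borel_measurable (generated_sigma M {..t} r)"
    using assms by (intro measurable_generated_sigma) simp
qed

lemma measurable_joint_past_scheduling:
  assumes "k < t"
  shows "\<mu> k \<in> borel_measurable (joint_past M \<mu> r t)"
proof (rule measurable_from_subalg)
  show "subalgebra (joint_past M \<mu> r t) (sched_past M \<mu> t)"
    by (auto simp: subalgebra_def sets_joint_past sched_past_def)
  show "\<mu> k \<in> borel_measurable (sched_past M \<mu> t)"
    unfolding sched_past_def using assms by (intro measurable_generated_sigma) simp
qed

lemma subalgebra_joint_past_mono:
  assumes "t \<le> u"
  shows "subalgebra (joint_past M \<mu> r u) (joint_past M \<mu> r t)"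
proof -
  have "sets (generated_sigma M {..t} r) \<subseteq> sets (joint_past M \<mu> r u)"
    using assms by (intro sets_generated_sigma_subset measurable_joint_past_process) auto
  moreover have "sets (sched_past M \<mu> t) \<subseteq> sets (joint_past M \<mu> r u)"
    unfolding sched_past_def
    using assms by (intro sets_generated_sigma_subset measurable_joint_past_scheduling) auto
  ultimately show ?thesis
    unfolding subalgebra_def sets_joint_past[of M \<mu> r t]
    using sets.sigma_sets_subset[of _ "joint_past M \<mu> r u"] by (metis Un_least space_joint_past)
qed

lemma measurable_joint_past_mono:
  assumes "f \<in> borel_measurable (joint_past M \<mu> r t)" "t \<le> u"
  shows "f \<in> borel_measurable (joint_past M \<mu> r u)"
  by (rule measurable_from_subalg[OF subalgebra_joint_past_mono[OF assms(2)] assms(1)])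

text \<open>
  The present of the scheduling has the same second moments given the joint past as given its own
  past. This makes the contributions of distinct letters orthogonal.
\<close>

lemma scheduled_moment:
  fixes f :: "'a \<Rightarrow> real"
  assumes M: "prob_space M" and adm: "admissible M \<mu> p" and r: "ZMWSII M \<mu> p r"
    and f: "f \<in> borel_measurable (joint_past M \<mu> r t)"
    and int: "integrable M (\<lambda>\<omega>. f \<omega> * (\<mu> t \<omega> $ \<sigma> * \<mu> t \<omega> $ \<sigma>'))"
  shows "(\<integral>\<omega>. f \<omega> * (\<mu> t \<omega> $ \<sigma> * \<mu> t \<omega> $ \<sigma>') \<partial>M)
    = (if \<sigma> = \<sigma>' then p \<sigma> else 0) * (\<integral>\<omega>. f \<omega> \<partial>M)"
proof (rule cond_indep_integral_mult[OF M])
  let ?G = "generated_sigma M {t..} \<mu>"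
  show "cond_indep_sigma M (generated_sigma M {..t} r) ?G (sched_past M \<mu> t)"
    using spec[OF conjunct1[OF r[unfolded ZMWSII_def]], of t]
    unfolding sched_past_def generated_sigma_components .
  have "square_integrable M (r k)" for k
    by (rule ZMWSII_square_integrable[OF r])
  then show "subalgebra M (generated_sigma M {..t} r)"
    by (intro subalgebra_generated_sigma) (auto simp: square_integrable_def)
  show "subalgebra M ?G"
    by (intro subalgebra_generated_sigma admissible_measurable[OF adm])
  show "subalgebra M (sched_past M \<mu> t)"
    by (rule subalgebra_sched_past[OF adm])
  show "(\<lambda>\<omega>. \<mu> t \<omega> $ \<sigma> * \<mu> t \<omega> $ \<sigma>') \<in> borel_measurable ?G"
    by (intro borel_measurable_times borel_measurable_vec_nth measurable_generated_sigma) auto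
  show "integrable M (\<lambda>\<omega>. \<mu> t \<omega> $ \<sigma> * \<mu> t \<omega> $ \<sigma>')"
    using square_integrable_mult[OF admissible_square_integrable[OF adm, of "[\<sigma>]" t]
        admissible_square_integrable[OF adm, of "[\<sigma>']" t]]
    by (simp add: sched_prod_Cons)
  show "f \<in> borel_measurable (sigma (space M) (sets (generated_sigma M {..t} r) \<union> sets (sched_past M \<mu> t)))"
    using f by (simp add: joint_past_def)
qed (rule admissible_second_moment[OF M adm] int)+

section \<open>Contribution of the initial state\<close>

text \<open>
  The state at time \<open>s + n\<close> of the recursion without input, started from \<open>x s\<close> at time \<open>s\<close>.
\<close>

primrec free_response ::
  "(int \<Rightarrow> 'a \<Rightarrow> real^'s) \<Rightarrow> ('s::finite \<Rightarrow> real^'n^'n) \<Rightarrow> (int \<Rightarrow> 'a \<Rightarrow> real^'n) \<Rightarrow>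
    int \<Rightarrow> nat \<Rightarrow> 'a \<Rightarrow> real^'n" where
  "free_response \<mu> A x s 0 \<omega> = x s \<omega>"
| "free_response \<mu> A x s (Suc n) \<omega> =
    (\<Sum>i\<in>UNIV. (\<mu> (s + int n) \<omega> $ i) *\<^sub>R (A i *v free_response \<mu> A x s n \<omega>))"

lemma free_response_Suc_nth:
  "free_response \<mu> A x s (Suc n) \<omega> $ a =
    (\<Sum>i\<in>UNIV. \<Sum>c\<in>UNIV. A i $ a $ c * (\<mu> (s + int n) \<omega> $ i * free_response \<mu> A x s n \<omega> $ c))"
  by (simp add: matrix_vector_mult_def sum_distrib_left mult.left_commute)

text \<open>
  The word \<open>w\<close> of scheduling factors after time \<open>s + n\<close> is there for the induction: a step of the
  recursion moves one letter from the free response to the front of \<open>w\<close>, until only a weighted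
  copy of \<open>x s\<close> remains.
\<close>

lemma free_response_square_integrable:
  fixes x :: "int \<Rightarrow> 'a \<Rightarrow> real^'n"
  assumes "\<And>w t a. square_integrable M (\<lambda>\<omega>. sched_prod \<mu> w (t + int (length w) - 1) \<omega> * x t \<omega> $ a)"
  shows "square_integrable M
    (\<lambda>\<omega>. sched_prod \<mu> w (s + int n + int (length w) - 1) \<omega> * free_response \<mu> A x s n \<omega> $ a)"
proof (induction n arbitrary: w a)
  case 0
  show ?case using assms[of w s a] by simp
next
  case (Suc n)
  let ?T = "s + int n + int (length w)"
  have "sched_prod \<mu> w ?T \<omega> * free_response \<mu> A x s (Suc n) \<omega> $ a =
     (\<Sum>i\<in>UNIV. \<Sum>c\<in>UNIV. A i $ a $ c * (sched_prod \<mu> (i # w) ?T \<omega> * free_response \<mu> A x s n \<omega> $ c))" for \<omega>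
    unfolding free_response_Suc_nth sum_distrib_left by (simp add: sched_prod_Cons mult_ac)
  moreover have "square_integrable M (\<lambda>\<omega>. \<Sum>i\<in>UNIV. \<Sum>c\<in>UNIV.
      A i $ a $ c * (sched_prod \<mu> (i # w) ?T \<omega> * free_response \<mu> A x s n \<omega> $ c))"
  proof (intro square_integrable_sum square_integrable_cmult)
    show "square_integrable M (\<lambda>\<omega>. sched_prod \<mu> (i # w) ?T \<omega> * free_response \<mu> A x s n \<omega> $ c)" for i c
      using Suc.IH[of "i # w" c] by (simp add: add.assoc)
  qed
  ultimately show ?case by (simp add: algebra_simps)
qed

lemma free_response_measurable:
  assumes "\<And>a. (\<lambda>\<omega>. x s \<omega> $ a) \<in> borel_measurable (joint_past M \<mu> r s)"
  shows "(\<lambda>\<omega>. free_response \<mu> A x s n \<omega> $ a) \<in> borel_measurable (joint_past M \<mu> r (s + int n))"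
proof (induction n arbitrary: a)
  case 0
  show ?case using assms by simp
next
  case (Suc n)
  have "(\<lambda>\<omega>. free_response \<mu> A x s n \<omega> $ c) \<in> borel_measurable (joint_past M \<mu> r (s + int (Suc n)))" for c
    by (rule measurable_joint_past_mono[OF Suc.IH]) simp
  moreover have "(\<lambda>\<omega>. \<mu> (s + int n) \<omega> $ i) \<in> borel_measurable (joint_past M \<mu> r (s + int (Suc n)))" for i
    by (intro borel_measurable_vec_nth measurable_joint_past_scheduling) simp
  ultimately show ?case
    unfolding free_response_Suc_nth
    by (intro borel_measurable_sum borel_measurable_times borel_measurable_const) auto
qed

text \<open>
  On vectors indexed by pairs, that is on matrices \<open>P\<close>, the sum of Kronecker squares is the map
  \<open>P \<mapsto> (\<Sum>i. p\<^sub>i A\<^sub>i P A\<^sub>i\<^sup>T)\<close>.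
\<close>

lemma kronecker_sum_mult_nth:
  fixes A :: "'s::finite \<Rightarrow> real^'n^'n" and q :: "real^('n \<times> 'n)"
  shows "((\<Sum>i\<in>UNIV. p i *\<^sub>R kronecker (A i) (A i)) *v q) $ (a, b) =
    (\<Sum>i\<in>UNIV. \<Sum>c\<in>UNIV. \<Sum>d\<in>UNIV. p i * (A i $ a $ c * A i $ b $ d) * q $ (c, d))"
proof -
  have "((\<Sum>i\<in>UNIV. p i *\<^sub>R kronecker (A i) (A i)) *v q) $ (a, b) =
      (\<Sum>j\<in>UNIV. \<Sum>i\<in>UNIV. p i * (A i $ a $ fst j * A i $ b $ snd j) * q $ j)"
    by (simp add: matrix_vector_mult_def kronecker_def sum_distrib_right)
  also have "\<dots> = (\<Sum>i\<in>UNIV. \<Sum>j\<in>UNIV. p i * (A i $ a $ fst j * A i $ b $ snd j) * q $ j)"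
    by (rule sum.swap)
  also have "\<dots> = (\<Sum>i\<in>UNIV. \<Sum>c\<in>UNIV. \<Sum>d\<in>UNIV. p i * (A i $ a $ c * A i $ b $ d) * q $ (c, d))"
    unfolding UNIV_Times_UNIV[symmetric] sum.cartesian_product by (simp add: case_prod_unfold)
  finally show ?thesis .
qed

text \<open>
  The matrix \<open>E[X X\<^sup>T]\<close>, read as a vector so that Kronecker products act on it by multiplication.
\<close>

definition second_moments :: "'a measure \<Rightarrow> ('a \<Rightarrow> real^'n) \<Rightarrow> real^('n \<times> 'n)" where
  "second_moments M X = (\<chi> j. \<integral>\<omega>. X \<omega> $ fst j * X \<omega> $ snd j \<partial>M)"

text \<open>
  Expanding the product of two components gives the terms \<open>E[\<mu>\<^sub>i \<mu>\<^sub>j R\<^sub>c R\<^sub>d]\<close>; the free response \<open>R\<close>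
  is determined by the joint past, so \<open>scheduled_moment\<close> keeps only those with \<open>i = j\<close>.
\<close>

lemma second_moments_free_response_Suc:
  fixes x :: "int \<Rightarrow> 'a \<Rightarrow> real^'n" and \<mu> :: "int \<Rightarrow> 'a \<Rightarrow> real^'s::finite" and r :: "int \<Rightarrow> 'a \<Rightarrow> real^'k"
  assumes M: "prob_space M" and adm: "admissible M \<mu> p" and r: "ZMWSII M \<mu> p r"
    and meas: "\<And>a. (\<lambda>\<omega>. x s \<omega> $ a) \<in> borel_measurable (joint_past M \<mu> r s)"
    and sq: "\<And>w t a. square_integrable M (\<lambda>\<omega>. sched_prod \<mu> w (t + int (length w) - 1) \<omega> * x t \<omega> $ a)"
  shows "second_moments M (free_response \<mu> A x s (Suc n)) =
    (\<Sum>i\<in>UNIV. p i *\<^sub>R kronecker (A i) (A i)) *v second_moments M (free_response \<mu> A x s n)"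
proof -
  define R where "R = free_response \<mu> A x s n"
  define m where "m = (\<lambda>i \<omega>. \<mu> (s + int n) \<omega> $ i)"
  have sqR: "square_integrable M (\<lambda>\<omega>. m i \<omega> * R \<omega> $ c)" for i c
    using free_response_square_integrable[OF sq, of "[i]" s n A c]
    by (simp add: sched_prod_Cons m_def R_def)
  have int: "integrable M (\<lambda>\<omega>. (m i \<omega> * R \<omega> $ c) * (m j \<omega> * R \<omega> $ d))" for i j c d
    by (rule square_integrable_mult[OF sqR sqR])
  have step: "(\<integral>\<omega>. (m i \<omega> * R \<omega> $ c) * (m j \<omega> * R \<omega> $ d) \<partial>M) =
      (if i = j then p i else 0) * second_moments M R $ (c, d)" for i j c d
  proof -
    have "integrable M (\<lambda>\<omega>. (R \<omega> $ c * R \<omega> $ d) * (m i \<omega> * m j \<omega>))"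
      using int[of i c j d] by (simp add: mult_ac)
    moreover have "(\<lambda>\<omega>. R \<omega> $ c * R \<omega> $ d) \<in> borel_measurable (joint_past M \<mu> r (s + int n))"
      unfolding R_def by (intro borel_measurable_times free_response_measurable[of x s M \<mu> r, OF meas])
    ultimately have "(\<integral>\<omega>. (R \<omega> $ c * R \<omega> $ d) * (m i \<omega> * m j \<omega>) \<partial>M)
        = (if i = j then p i else 0) * (\<integral>\<omega>. R \<omega> $ c * R \<omega> $ d \<partial>M)"
      unfolding m_def by (intro scheduled_moment[OF M adm r])
    then show ?thesis by (simp add: second_moments_def mult_ac)
  qed
  have "second_moments M (free_response \<mu> A x s (Suc n)) $ (a, b) =
    ((\<Sum>i\<in>UNIV. p i *\<^sub>R kronecker (A i) (A i)) *v second_moments M R) $ (a, b)" for a b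
  proof -
    have "second_moments M (free_response \<mu> A x s (Suc n)) $ (a, b) =
      (\<integral>\<omega>. (\<Sum>i\<in>UNIV. \<Sum>c\<in>UNIV. A i $ a $ c * (m i \<omega> * R \<omega> $ c)) *
           (\<Sum>j\<in>UNIV. \<Sum>d\<in>UNIV. A j $ b $ d * (m j \<omega> * R \<omega> $ d)) \<partial>M)"
      unfolding second_moments_def free_response_Suc_nth by (simp add: m_def R_def)
    also have "\<dots> = (\<integral>\<omega>. (\<Sum>i\<in>UNIV. \<Sum>j\<in>UNIV. \<Sum>c\<in>UNIV. \<Sum>d\<in>UNIV.
        A i $ a $ c * A j $ b $ d * ((m i \<omega> * R \<omega> $ c) * (m j \<omega> * R \<omega> $ d))) \<partial>M)"
      unfolding sum_product by (simp add: mult_ac)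
    also have "\<dots> = (\<Sum>i\<in>UNIV. \<Sum>j\<in>UNIV. \<Sum>c\<in>UNIV. \<Sum>d\<in>UNIV.
        A i $ a $ c * A j $ b $ d * ((if i = j then p i else 0) * second_moments M R $ (c, d)))"
      using int by (simp add: step)
    also have "\<dots> = (\<Sum>i\<in>UNIV. \<Sum>j\<in>UNIV. if i = j then (\<Sum>c\<in>UNIV. \<Sum>d\<in>UNIV.
        p i * (A i $ a $ c * A j $ b $ d) * second_moments M R $ (c, d)) else 0)"
      by (intro sum.cong refl) (auto simp: mult_ac)
    also have "\<dots> = (\<Sum>i\<in>UNIV. \<Sum>c\<in>UNIV. \<Sum>d\<in>UNIV.
        p i * (A i $ a $ c * A i $ b $ d) * second_moments M R $ (c, d))"
      by simp
    finally show ?thesis unfolding kronecker_sum_mult_nth .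
  qed
  then show ?thesis by (simp add: vec_eq_iff R_def)
qed

text \<open>
  By linearity the difference is the response to the inputs \<open>y s, \<dots>, y (s + n - 1)\<close> alone. The
  word \<open>w\<close> of later scheduling factors again makes the induction work: the input at time \<open>s + n\<close>,
  multiplied by the factor of \<open>i # w\<close>, is a multiple of \<open>z\<^sup>y\<close> at the word \<open>i # w\<close> and time \<open>t\<close>.
\<close>

lemma state_minus_free_response_in_span:
  fixes x :: "int \<Rightarrow> 'a \<Rightarrow> real^'n" and y :: "int \<Rightarrow> 'a \<Rightarrow> real^'m"
    and A :: "'s::finite \<Rightarrow> real^'n^'n" and K :: "'s \<Rightarrow> real^'m^'n"
  assumes p: "\<And>\<sigma>. p \<sigma> > 0"
    and sq: "\<And>w t a. square_integrable M (\<lambda>\<omega>. sched_prod \<mu> w (t + int (length w) - 1) \<omega> * x t \<omega> $ a)"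
    and rec: "\<And>t. AE \<omega> in M. x (t + 1) \<omega> = (\<Sum>i\<in>UNIV. (\<mu> t \<omega> $ i) *\<^sub>R (A i *v x t \<omega> + K i *v y t \<omega>))"
    and V: "L2_closed_subspace M V"
    and zV: "\<And>w j. w \<noteq> [] \<Longrightarrow> (\<lambda>\<omega>. zproc \<mu> p y w t \<omega> $ j) \<in> V"
    and t: "t = s + int n + int (length w)"
  shows "(\<lambda>\<omega>. sched_prod \<mu> w (t - 1) \<omega> * (x (s + int n) \<omega> $ a - free_response \<mu> A x s n \<omega> $ a)) \<in> V"
  using t
proof (induction n arbitrary: w a)
  case 0
  then show ?case using L2_closed_subspaceD_zero[OF V] by simp
next
  case (Suc n)
  have t: "t = s + int n + int (length (i # w))" for i :: 's
    using Suc.prems by simp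
  define D where "D = (\<lambda>c \<omega>. x (s + int n) \<omega> $ c - free_response \<mu> A x s n \<omega> $ c)"
  let ?f = "\<lambda>\<omega>. \<Sum>i\<in>UNIV. (\<Sum>c\<in>UNIV. A i $ a $ c * (sched_prod \<mu> (i # w) (t - 1) \<omega> * D c \<omega>)) +
      (\<Sum>c\<in>UNIV. K i $ a $ c * (sqrt (word_weight p (i # w)) * zproc \<mu> p y (i # w) t \<omega> $ c))"
  have fV: "?f \<in> V"
  proof (intro L2_closed_subspace_sum[OF V] L2_closed_subspaceD_add[OF V] L2_closed_subspaceD_cmult[OF V])
    show "(\<lambda>\<omega>. sched_prod \<mu> (i # w) (t - 1) \<omega> * D c \<omega>) \<in> V" for i c
      unfolding D_def by (rule Suc.IH[OF t])
    show "(\<lambda>\<omega>. zproc \<mu> p y (i # w) t \<omega> $ c) \<in> V" for i c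
      by (rule zV) simp
  qed
  have z: "sqrt (word_weight p (i # w)) * zproc \<mu> p y (i # w) t \<omega> $ c =
      sched_prod \<mu> (i # w) (t - 1) \<omega> * y (s + int n) \<omega> $ c" for i c \<omega>
    unfolding t[of i] by (rule sched_prod_eq_zproc[OF p, symmetric])
  have eq: "AE \<omega> in M. ?f \<omega> = sched_prod \<mu> w (t - 1) \<omega> *
      (x (s + int (Suc n)) \<omega> $ a - free_response \<mu> A x s (Suc n) \<omega> $ a)"
    using rec[of "s + int n"]
  proof eventually_elim
    case (elim \<omega>)
    have "s + int (Suc n) = s + int n + 1" by simp
    then have "x (s + int (Suc n)) \<omega> $ a = x (s + int n + 1) \<omega> $ a" by (simp only:)
    also have "\<dots> = (\<Sum>i\<in>UNIV. \<mu> (s + int n) \<omega> $ i *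
        ((\<Sum>c\<in>UNIV. A i $ a $ c * x (s + int n) \<omega> $ c) + (\<Sum>c\<in>UNIV. K i $ a $ c * y (s + int n) \<omega> $ c)))"
      unfolding elim by (simp add: matrix_vector_mult_def)
    finally have X: "x (s + int (Suc n)) \<omega> $ a = \<dots>" .
    have F: "free_response \<mu> A x s (Suc n) \<omega> $ a = (\<Sum>i\<in>UNIV. \<mu> (s + int n) \<omega> $ i *
        (\<Sum>c\<in>UNIV. A i $ a $ c * free_response \<mu> A x s n \<omega> $ c))"
      by (simp add: matrix_vector_mult_def)
    have D: "(\<Sum>c\<in>UNIV. A i $ a $ c * D c \<omega>) = (\<Sum>c\<in>UNIV. A i $ a $ c * x (s + int n) \<omega> $ c) -
        (\<Sum>c\<in>UNIV. A i $ a $ c * free_response \<mu> A x s n \<omega> $ c)" for i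
      by (simp add: D_def right_diff_distrib sum_subtractf)
    have "x (s + int (Suc n)) \<omega> $ a - free_response \<mu> A x s (Suc n) \<omega> $ a =
      (\<Sum>i\<in>UNIV. \<mu> (s + int n) \<omega> $ i *
        ((\<Sum>c\<in>UNIV. A i $ a $ c * D c \<omega>) + (\<Sum>c\<in>UNIV. K i $ a $ c * y (s + int n) \<omega> $ c)))"
      unfolding X F D
      by (subst sum_subtractf[symmetric], intro sum.cong refl) (simp only: algebra_simps)
    moreover have "sched_prod \<mu> (i # w) (t - 1) \<omega> = sched_prod \<mu> w (t - 1) \<omega> * \<mu> (s + int n) \<omega> $ i" for i
    proof -
      have "t - 1 - int (length w) = s + int n" using Suc.prems by simp
      then show ?thesis by (simp add: sched_prod_Cons)
    qed
    ultimately show ?case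
      unfolding z by (simp add: sum_distrib_left distrib_left mult_ac)
  qed
  have T: "s + int (Suc n) + int (length w) - 1 = t - 1" using Suc.prems by simp
  have "square_integrable M (\<lambda>\<omega>. sched_prod \<mu> w (t - 1) \<omega> * x (s + int (Suc n)) \<omega> $ a -
      sched_prod \<mu> w (t - 1) \<omega> * free_response \<mu> A x s (Suc n) \<omega> $ a)"
    using sq[of w "s + int (Suc n)" a] free_response_square_integrable[OF sq, of w s "Suc n" A a]
    unfolding T by (rule square_integrable_diff)
  then show ?case
    unfolding right_diff_distrib[symmetric]
    by (intro L2_closed_subspace_AE[OF V fV _ eq]) (simp add: square_integrable_real_iff)
qed

text \<open>
  The free responses started at time \<open>t - n\<close> have the second moments \<open>B\<^sup>n q\<close>, where \<open>B\<close> is the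
  stable Kronecker sum and \<open>q\<close> the stationary second moments of the state. They vanish in the
  limit, and what remains of \<open>x t\<close> is in the closed subspace for every \<open>n\<close>.
\<close>

lemma state_in_output_past:
  fixes x :: "int \<Rightarrow> 'a \<Rightarrow> real^'n" and y :: "int \<Rightarrow> 'a \<Rightarrow> real^'m" and r :: "int \<Rightarrow> 'a \<Rightarrow> real^'k"
    and A :: "'s::finite \<Rightarrow> real^'n^'n" and K :: "'s \<Rightarrow> real^'m^'n"
  assumes M: "prob_space M" and adm: "admissible M \<mu> p" and r: "ZMWSII M \<mu> p r"
    and meas: "\<And>s a. (\<lambda>\<omega>. x s \<omega> $ a) \<in> borel_measurable (joint_past M \<mu> r s)"
    and stationary: "\<And>s t. second_moments M (x s) = second_moments M (x t)"
    and sq: "\<And>w t a. square_integrable M (\<lambda>\<omega>. sched_prod \<mu> w (t + int (length w) - 1) \<omega> * x t \<omega> $ a)"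
    and rec: "\<And>t. AE \<omega> in M. x (t + 1) \<omega> = (\<Sum>i\<in>UNIV. (\<mu> t \<omega> $ i) *\<^sub>R (A i *v x t \<omega> + K i *v y t \<omega>))"
    and stable: "eigenvalues_in_open_unit_disk (\<Sum>i\<in>UNIV. p i *\<^sub>R kronecker (A i) (A i))"
    and V: "L2_closed_subspace M V"
    and zV: "\<And>w j. w \<noteq> [] \<Longrightarrow> (\<lambda>\<omega>. zproc \<mu> p y w t \<omega> $ j) \<in> V"
  shows "(\<lambda>\<omega>. x t \<omega> $ a) \<in> V"
proof (rule L2_closed_subspaceD_limit[OF V])
  let ?B = "\<Sum>i\<in>UNIV. p i *\<^sub>R kronecker (A i) (A i)"
  let ?R = "\<lambda>n. free_response \<mu> A x (t - int n) n"
  show "(\<lambda>\<omega>. x t \<omega> $ a - ?R n \<omega> $ a) \<in> V" for n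
    using state_minus_free_response_in_span[OF admissible_pos[OF adm] sq rec V zV,
        where s = "t - int n" and n = n and w = "[]" and a = a]
    by simp
  show "square_integrable M (\<lambda>\<omega>. x t \<omega> $ a)"
    using sq[of "[]" t a] by simp
  have mom: "second_moments M (free_response \<mu> A x s n) = (((*v) ?B) ^^ n) (second_moments M (x t))" for s n
  proof (induction n)
    case 0
    show ?case using stationary[of s t] by (simp add: second_moments_def)
  next
    case (Suc n)
    show ?case
      unfolding second_moments_free_response_Suc[OF M adm r meas sq] Suc by simp
  qed
  have "(\<lambda>n. second_moments M (?R n) $ (a, a)) \<longlonglongrightarrow> 0"
    unfolding mom by (rule matrix_powers_tendsto_zero[OF stable])
  moreover have "second_moments M (?R n) $ (a, a) = (\<integral>\<omega>. ((x t \<omega> $ a - ?R n \<omega> $ a) - x t \<omega> $ a)\<^sup>2 \<partial>M)" for n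
    by (simp add: second_moments_def power2_eq_square)
  ultimately show "(\<lambda>n. \<integral>\<omega>. ((x t \<omega> $ a - ?R n \<omega> $ a) - x t \<omega> $ a)\<^sup>2 \<partial>M) \<longlonglongrightarrow> 0"
    by simp
qed

section \<open>The innovation\<close>

theorem theorem3:
  fixes M :: "'a measure"
    and \<mu> :: "int \<Rightarrow> 'a \<Rightarrow> real^'s::finite"
    and p :: "'s \<Rightarrow> real"
    and y v :: "int \<Rightarrow> 'a \<Rightarrow> real^'ny::finite"
    and x :: "int \<Rightarrow> 'a \<Rightarrow> real^'nx::finite"
    and A :: "'s \<Rightarrow> real^'nx^'nx"
    and K :: "'s \<Rightarrow> real^'ny^'nx"
    and C :: "real^'nx^'ny"
  assumes "prob_space M"
    and "admissible M \<mu> p"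
    and "SII M \<mu> p y"
    and "full_rank M \<mu> p y"
    and "asLPV_SSA M \<mu> p A K C (mat 1) v x y"
    and "stably_invertible p A K C"
  shows "innovation_form M \<mu> p A K C (mat 1) v x y"
proof -
  note adm = assms(2)
  note sys = assms(5)[unfolded asLPV_SSA_def]
  note rec = spec[OF conjunct1[OF sys]]
  note sys = conjunct2[OF sys]
  note out = spec[OF conjunct1[OF sys]]
  note sys = conjunct2[OF sys]
  note xv = conjunct1[OF sys]
  note sys = conjunct2[OF conjunct2[OF sys]]
  note vx = mp[OF spec[OF spec[OF conjunct1[OF sys]]]]
  note sys = conjunct2[OF sys]
  note v = conjunct1[OF sys]
  note vv = mp[OF spec[OF spec[OF conjunct1[OF conjunct2[OF sys]]]]]
  note p = admissible_pos[OF adm]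
  \<comment> \<open>the empty word in the definition of \<open>SII\<close>\<close>
  have y_meas: "y t \<in> borel_measurable M" for t
  proof -
    show ?thesis
      using assms(3)[unfolded SII_def, THEN spec[where x="[]"], THEN spec[where x=t]]
      by (simp add: word_weight_def square_integrable_def)
  qed
  have xn: "x t \<omega> $ a = stack x v t \<omega> $ Inl a" for t \<omega> a
    by (simp add: stack_def)
  have meas: "(\<lambda>\<omega>. x s \<omega> $ a) \<in> borel_measurable (joint_past M \<mu> (stack x v) s)" for s a
    unfolding xn by (intro borel_measurable_vec_nth measurable_joint_past_process) simp
  have stationary: "second_moments M (x s) = second_moments M (x t)" for s t
  proof -
    have "cross_moment M (stack x v s) (stack x v s) = cross_moment M (stack x v t) (stack x v t)"
      using ZMWSII_cross_moment[OF xv, of 0 s 0] ZMWSII_cross_moment[OF xv, of 0 t 0] by simp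
    then have "cross_moment M (stack x v s) (stack x v s) $ Inl a $ Inl b =
        cross_moment M (stack x v t) (stack x v t) $ Inl a $ Inl b" for a b
      by simp
    then show ?thesis
      by (simp add: second_moments_def cross_moment_def xn)
  qed
  have sq: "square_integrable M (\<lambda>\<omega>. sched_prod \<mu> w (t + int (length w) - 1) \<omega> * x t \<omega> $ a)" for w t a
  proof (cases "w = []")
    case True
    then show ?thesis
      using square_integrable_nth[OF ZMWSII_square_integrable[OF xv], of t "Inl a"] by (simp add: xn)
  next
    case False
    show ?thesis
      unfolding xn sched_prod_eq_zproc[of p, OF p]
      by (intro square_integrable_cmult square_integrable_nth ZMWSII_square_integrable_zproc[OF xv] False)
  qed
  have closed_loop: "AE \<omega> in M. x (t + 1) \<omega> =
      (\<Sum>i\<in>UNIV. (\<mu> t \<omega> $ i) *\<^sub>R ((A i - K i ** C) *v x t \<omega> + K i *v y t \<omega>))" for t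
    using rec[of t] out[of t]
  proof eventually_elim
    case (elim \<omega>)
    have "(A i - K i ** C) *v x t \<omega> + K i *v y t \<omega> = A i *v x t \<omega> + K i *v v t \<omega>" for i
      unfolding elim(2)
      by (simp add: matrix_vector_mult_diff_rdistrib matrix_vector_mul_assoc[symmetric] matrix_vector_right_distrib)
    with elim(1) show ?case by simp
  qed
  \<comment> \<open>\<open>C x t\<close> is the projection of \<open>y t\<close>, because \<open>v t\<close> is orthogonal to the past outputs\<close>
  have "AE \<omega> in M. v t \<omega> = innovation M \<mu> p y t \<omega>" for t
  proof -
    define S where "S = {\<lambda>\<omega>. zproc \<mu> p y w t \<omega> $ j | w j. w \<noteq> []}"
    have sx: "square_integrable M (\<lambda>\<omega>. x t \<omega> $ c)" for c
      using sq[of "[]" t c] by simp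
    have sv: "square_integrable M (\<lambda>\<omega>. v t \<omega> $ i)" for i
      by (intro square_integrable_nth ZMWSII_square_integrable[OF v])
    have szv: "square_integrable M (\<lambda>\<omega>. zproc \<mu> p v w t \<omega> $ j)" if "w \<noteq> []" for w j
      by (intro square_integrable_nth ZMWSII_square_integrable_zproc[OF v] that)
    have szx: "square_integrable M (\<lambda>\<omega>. zproc \<mu> p x w t \<omega> $ c)" if "w \<noteq> []" for w c
      using square_integrable_nth[OF ZMWSII_square_integrable_zproc[OF xv that], of t "Inl c"]
      by (simp add: zproc_nth stack_def)
    have zy: "AE \<omega> in M. (\<Sum>c\<in>UNIV. C $ j $ c * zproc \<mu> p x w t \<omega> $ c) + zproc \<mu> p v w t \<omega> $ j
        = zproc \<mu> p y w t \<omega> $ j" for w j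
      using out[of "t - int (length w)"]
      by eventually_elim
        (simp add: zproc_nth matrix_vector_mult_def[of C] distrib_left sum_distrib_left mult_ac)
    have zy_meas: "(\<lambda>\<omega>. zproc \<mu> p y w t \<omega> $ j) \<in> borel_measurable M" if "w \<noteq> []" for w j
      using admissible_square_integrable[OF adm that, of "t - 1"]
      unfolding zproc_nth square_integrable_real_iff
      by (intro borel_measurable_times borel_measurable_const borel_measurable_vec_nth y_meas) simp
    have szy: "square_integrable M (\<lambda>\<omega>. zproc \<mu> p y w t \<omega> $ j)" if "w \<noteq> []" for w j
      by (rule square_integrable_AE_cong[OF _ zy_meas[OF that] zy])
        (intro square_integrable_add square_integrable_sum square_integrable_cmult szx szv that)
    have S: "square_integrable M Z" if "Z \<in> S" for Z
      using that szy by (auto simp: S_def)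
    have orth: "(\<integral>\<omega>. v t \<omega> $ i * zproc \<mu> p y w t \<omega> $ j \<partial>M) = 0" if w: "w \<noteq> []" for w i j
    proof -
      have "cross_moment M (v t) (zproc \<mu> p x w t) $ i $ c = 0" for c
        by (simp add: vx[OF w])
      then have x0: "(\<integral>\<omega>. v t \<omega> $ i * zproc \<mu> p x w t \<omega> $ c \<partial>M) = 0" for c
        by (simp add: cross_moment_def)
      have "cross_moment M (v t) (zproc \<mu> p v w t) $ i $ j = 0"
        by (simp add: vv[OF w])
      then have v0: "(\<integral>\<omega>. v t \<omega> $ i * zproc \<mu> p v w t \<omega> $ j \<partial>M) = 0"
        by (simp add: cross_moment_def)
      note ix = square_integrable_mult[OF sv szx[OF w]] and iv = square_integrable_mult[OF sv szv[OF w]]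
      have "(\<integral>\<omega>. v t \<omega> $ i * zproc \<mu> p y w t \<omega> $ j \<partial>M) =
          (\<integral>\<omega>. (\<Sum>c\<in>UNIV. C $ j $ c * (v t \<omega> $ i * zproc \<mu> p x w t \<omega> $ c)) +
              v t \<omega> $ i * zproc \<mu> p v w t \<omega> $ j \<partial>M)"
      proof (rule integral_cong_AE)
        show "AE \<omega> in M. v t \<omega> $ i * zproc \<mu> p y w t \<omega> $ j =
          (\<Sum>c\<in>UNIV. C $ j $ c * (v t \<omega> $ i * zproc \<mu> p x w t \<omega> $ c)) +
              v t \<omega> $ i * zproc \<mu> p v w t \<omega> $ j"
          using zy[of j w]
        proof eventually_elim
          case (elim \<omega>)
          show ?case
            unfolding elim[symmetric] by (simp add: distrib_left sum_distrib_left mult_ac)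
        qed
        show "(\<lambda>\<omega>. v t \<omega> $ i * zproc \<mu> p y w t \<omega> $ j) \<in> borel_measurable M"
          by (rule borel_measurable_integrable[OF square_integrable_mult[OF sv szy[OF w]]])
        show "(\<lambda>\<omega>. (\<Sum>c\<in>UNIV. C $ j $ c * (v t \<omega> $ i * zproc \<mu> p x w t \<omega> $ c)) +
              v t \<omega> $ i * zproc \<mu> p v w t \<omega> $ j) \<in> borel_measurable M"
          by (intro borel_measurable_add borel_measurable_sum borel_measurable_times[OF borel_measurable_const]
              borel_measurable_integrable[OF ix] borel_measurable_integrable[OF iv])
      qed
      also have "\<dots> = 0"
        using ix iv by (simp add: x0 v0)
      finally show ?thesis .
    qed
    have proj: "AE \<omega> in M. lin_proj M S (\<lambda>\<omega>. y t \<omega> $ i) \<omega> = (C *v x t \<omega>) $ i" for i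
    proof (rule lin_proj_AE_eq[OF S])
      have out_i: "AE \<omega> in M. (\<Sum>c\<in>UNIV. C $ i $ c * x t \<omega> $ c) + v t \<omega> $ i = y t \<omega> $ i"
        using out[of t] by eventually_elim (simp add: matrix_vector_mult_def[of C])
      show sy: "square_integrable M (\<lambda>\<omega>. y t \<omega> $ i)"
        by (rule square_integrable_AE_cong[OF _ borel_measurable_vec_nth[OF y_meas] out_i])
          (intro square_integrable_add square_integrable_sum square_integrable_cmult sx sv)
      have V: "L2_closed_subspace M (L2_closed_span M S)"
        by (rule L2_closed_subspace_span[OF S])
      have "(\<lambda>\<omega>. x t \<omega> $ c) \<in> L2_closed_span M S" for c
      proof (rule state_in_output_past[OF assms(1) adm xv meas stationary sq closed_loop _ V])
        show "eigenvalues_in_open_unit_disk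
            (\<Sum>i\<in>UNIV. p i *\<^sub>R kronecker (A i - K i ** C) (A i - K i ** C))"
          using assms(6) by (simp add: stably_invertible_def)
        show "(\<lambda>\<omega>. zproc \<mu> p y w t \<omega> $ j) \<in> L2_closed_span M S" if "w \<noteq> []" for w j
          using L2_closed_span_superset[of S M] that by (auto simp: S_def)
      qed
      then show "(\<lambda>\<omega>. (C *v x t \<omega>) $ i) \<in> L2_closed_span M S"
        unfolding matrix_vector_mult_def vec_lambda_beta
        by (intro L2_closed_subspace_sum[OF V] L2_closed_subspaceD_cmult[OF V])
      fix Z assume "Z \<in> S"
      then obtain w j where Z: "Z = (\<lambda>\<omega>. zproc \<mu> p y w t \<omega> $ j)" and w: "w \<noteq> []"
        by (auto simp: S_def)
      have "(\<integral>\<omega>. (y t \<omega> $ i - (C *v x t \<omega>) $ i) * Z \<omega> \<partial>M) =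
          (\<integral>\<omega>. v t \<omega> $ i * zproc \<mu> p y w t \<omega> $ j \<partial>M)"
      proof (rule integral_cong_AE)
        show "AE \<omega> in M. (y t \<omega> $ i - (C *v x t \<omega>) $ i) * Z \<omega> = v t \<omega> $ i * zproc \<mu> p y w t \<omega> $ j"
          using out[of t] by eventually_elim (simp add: Z)
        have "square_integrable M (\<lambda>\<omega>. y t \<omega> $ i - (C *v x t \<omega>) $ i)"
          unfolding matrix_vector_mult_def vec_lambda_beta
          by (intro square_integrable_diff square_integrable_sum square_integrable_cmult sx sy)
        then show "(\<lambda>\<omega>. (y t \<omega> $ i - (C *v x t \<omega>) $ i) * Z \<omega>) \<in> borel_measurable M"
          unfolding Z by (intro borel_measurable_integrable square_integrable_mult szy w)
        show "(\<lambda>\<omega>. v t \<omega> $ i * zproc \<mu> p y w t \<omega> $ j) \<in> borel_measurable M"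
          by (intro borel_measurable_integrable square_integrable_mult sv szy w)
      qed
      then show "(\<integral>\<omega>. (y t \<omega> $ i - (C *v x t \<omega>) $ i) * Z \<omega> \<partial>M) = 0"
        using orth[OF w] by simp
    qed
    have "AE \<omega> in M. \<forall>i\<in>UNIV. lin_proj M S (\<lambda>\<omega>. y t \<omega> $ i) \<omega> = (C *v x t \<omega>) $ i"
      using proj by (intro AE_finite_allI) auto
    then show ?thesis
      using out[of t]
    proof eventually_elim
      case (elim \<omega>)
      have "innovation M \<mu> p y t \<omega> = y t \<omega> - (\<chi> i. lin_proj M S (\<lambda>\<omega>. y t \<omega> $ i) \<omega>)"
        by (simp only: innovation_def S_def)
      also have "\<dots> = y t \<omega> - C *v x t \<omega>"
        using elim(1) by (simp add: vec_eq_iff)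
      finally show ?case using elim(2) by simp
    qed
  qed
  then show ?thesis
    using assms(5) unfolding innovation_form_def by blast
qed

end
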